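(* All induced equators of $\Delta_{12,33}$ (defined in the context) are vertex links. That is, if $S$ is a subset of the vertex set of $\Delta_{12,33}$ such that the induced subcomplex $\Delta_{12,33}[S]$ is a simplicial $2$-sphere, then there is a vertex $v$ of $\Delta_{12,33}$ with $\Delta_{12,33}[S]=\mathrm{lk}_{\Delta_{12,33}}(v)$.
   Context: Simplicial complexes are finite abstract simplicial complexes; faces are written as strings of vertices (e.g. $x_1x_2y_3=\{x_1,x_2,y_3\}$), and $\langle F_1,\dots,F_k\rangle$ is the complex whose facets (inclusion-maximal faces) are $F_1,\dots,F_k$. The join is $\Delta*\Gamma=\{F\cup G: F\in\Delta, G\in\Gamma\}$, and $\{v\}*\Delta:=\Delta*\langle\{v\}\rangle$ is the cone. For a subset $W$ of the vertex set, the induced subcomplex is $\Delta[W]=\{F\in\Delta: F\subseteq W\}$. The link of a face $F$ is $\mathrm{lk}_\Delta(F)=\{G\in\Delta: F\cup G\in\Delta,\ F\cap G=\emptyset\}$, and $\mathrm{lk}_\Delta(v):=\mathrm{lk}_\Delta(\{v\})$. A complex is a simplicial $d$-sphere if its geometric realization is homeomorphic to $\mathbb{S}^d$. An induced equator of a simplicial $3$-sphere is an induced subcomplex that is a simplicial $2$-sphere. The complex $\Delta_{12,33}$ below is a simplicial $3$-sphere. For distinct elements $p_1,p_2,p_3,q_1,q_2,q_3$ put $$\Diamond([p_1,p_2,p_3],[q_1,q_2,q_3])=\langle\{p_1\},\{q_1\}\rangle*\langle\{p_2\},\{q_2\}\rangle*\langle\{p_3\},\{q_3\}\rangle,$$ an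 octahedral $2$-sphere in which $p_i$ and $q_i$ are non-adjacent for each $i$. Definition of $\Delta_{12,33}$: the vertex set is $\{x_1,x_2,x_3,y_1,y_2,y_3,z_1,z_2,z_3,v_1,v_2,v_3\}$ ($12$ distinct elements) and $\Delta_{12,33}=\Gamma_1\cup\Gamma_2$, where $$\Gamma_1=\{v_1\}*\Diamond([x_1,x_2,x_3],[y_1,y_2,y_3])\ \cup\ \{v_2\}*\Diamond([y_1,y_2,y_3],[z_1,z_2,z_3])\ \cup\ \{v_3\}*\Diamond([x_1,x_2,x_3],[z_3,z_1,z_2])$$ (contributing $24$ facets) and $$\Gamma_2=\langle x_1x_2y_3z_2,\ x_2y_1y_3z_2,\ x_2y_1z_2z_3,\ x_2x_3y_1z_3,\ x_3y_1y_2z_3,\ x_3y_2z_1z_3,\ x_1x_3y_2z_1,\ x_1y_2y_3z_1,\ x_1y_3z_1z_2\rangle$$ (contributing $9$ facets). *)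

theory Defs
  imports "HOL-Analysis.Analysis"
begin

definition simplicial_complex :: "'a set set \<Rightarrow> bool" where
  "simplicial_complex \<Delta> \<longleftrightarrow>
     finite \<Delta> \<and> (\<forall>F\<in>\<Delta>. finite F) \<and> (\<forall>F\<in>\<Delta>. \<forall>G. G \<subseteq> F \<longrightarrow> G \<in> \<Delta>)"

definition vertices :: "'a set set \<Rightarrow> 'a set" where
  "vertices \<Delta> = \<Union>\<Delta>"

definition generated_complex :: "'a set set \<Rightarrow> 'a set set" where
  "generated_complex \<F> = {F. \<exists>G\<in>\<F>. F \<subseteq> G}"

definition join_complex :: "'a set set \<Rightarrow> 'a set set \<Rightarrow> 'a set set" where
  "join_complex \<Delta> \<Gamma> = {F \<union> G | F G. F \<in> \<Delta> \<and> G \<in> \<Gamma>}"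

definition cone :: "'a \<Rightarrow> 'a set set \<Rightarrow> 'a set set" where
  "cone v \<Delta> = join_complex \<Delta> (generated_complex {{v}})"

definition induced_subcomplex :: "'a set set \<Rightarrow> 'a set \<Rightarrow> 'a set set" where
  "induced_subcomplex \<Delta> W = {F \<in> \<Delta>. F \<subseteq> W}"

definition link :: "'a set set \<Rightarrow> 'a set \<Rightarrow> 'a set set" where
  "link \<Delta> F = {G \<in> \<Delta>. F \<union> G \<in> \<Delta> \<and> F \<inter> G = {}}"

text \<open>
  The geometric realization in barycentric coordinates: a point is a family of nonnegative
  weights of total 1 whose support is a face. Faces are finite, so the sum is a finite one. As a
  complex has only finitely many vertices, the product topology induces on this set the usual
  (Euclidean) topology of the realization, even if the ambient type is infinite.
\<close>

definition geometric_realization :: "'a set set \<Rightarrow> ('a \<Rightarrow> real) topology" where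
  "geometric_realization \<Delta> = subtopology (powertop_real UNIV)
     {w. (\<forall>u. 0 \<le> w u) \<and> {u. w u \<noteq> 0} \<in> \<Delta> \<and> (\<Sum>u | w u \<noteq> 0. w u) = 1}"

definition simplicial_sphere :: "nat \<Rightarrow> 'a set set \<Rightarrow> bool" where
  "simplicial_sphere d \<Delta> \<longleftrightarrow>
     simplicial_complex \<Delta> \<and> geometric_realization \<Delta> homeomorphic_space nsphere d"

definition octahedron :: "'a \<times> 'a \<times> 'a \<Rightarrow> 'a \<times> 'a \<times> 'a \<Rightarrow> 'a set set" where
  "octahedron = (\<lambda>(p1, p2, p3) (q1, q2, q3).
     join_complex
       (join_complex (generated_complex {{p1}, {q1}}) (generated_complex {{p2}, {q2}}))
       (generated_complex {{p3}, {q3}}))"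

datatype vertex = X1 | X2 | X3 | Y1 | Y2 | Y3 | Z1 | Z2 | Z3 | V1 | V2 | V3

definition Gamma1 :: "vertex set set" where
  "Gamma1 = cone V1 (octahedron (X1, X2, X3) (Y1, Y2, Y3))
          \<union> cone V2 (octahedron (Y1, Y2, Y3) (Z1, Z2, Z3))
          \<union> cone V3 (octahedron (X1, X2, X3) (Z3, Z1, Z2))"

definition Gamma2 :: "vertex set set" where
  "Gamma2 = generated_complex
     {{X1, X2, Y3, Z2}, {X2, Y1, Y3, Z2}, {X2, Y1, Z2, Z3},
      {X2, X3, Y1, Z3}, {X3, Y1, Y2, Z3}, {X3, Y2, Z1, Z3},
      {X1, X3, Y2, Z1}, {X1, Y2, Y3, Z1}, {X1, Y3, Z1, Z2}}"

definition Delta_12_33 :: "vertex set set" where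
  "Delta_12_33 = Gamma1 \<union> Gamma2"

end

theory Submission
  imports Defs "HOL-Homology.Homology"
begin

text \<open>
  If \<open>\<Delta>[S]\<close> is a 2-sphere then it contains no tetrahedron (invariance of domain), it is not
  contractible, and it is connected and unicoherent: it is not the union of two connected induced
  subcomplexes with a disconnected intersection. A vertex v is dominated by another vertex u of S
  if u can be added to every face of \<open>\<Delta>[S]\<close> that contains v. Moving the weight of v to u then
  deforms \<open>\<Delta>[S]\<close> to \<open>\<Delta>[S - {v}]\<close>, and covers pull back along this retraction, so
  contractibility and the failure of connectedness or unicoherence may be tested after deleting
  dominated vertices. Every S other than the twelve vertex neighbourhoods contains a facet or
  reduces in this way to at most one vertex, to a disconnected complex, or to an induced cycle of
  length 4 or 5, as a decision tree on the membership of the vertices in S shows.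
\<close>

subsection \<open>Geometric realizations\<close>

text \<open>The hard sets are those whose induced complex deforms to a circle: they are connected
  and not contractible, so something must tell a circle from a 2-sphere. Unicoherence does this, and
  both it and connectedness are tested on vertex sets and edges alone (\<open>linked\<close>,
  \<open>circular\<close>). Restoring a dominated vertex is therefore a graph argument for these two
  obstructions; only contractibility is carried by an actual homotopy. The complex is flag, which
  has two uses. The link of a vertex is the subcomplex induced on its neighbours, so a set equal to
  some \<open>nbrs v\<close> already satisfies the conclusion. And u dominates v in S as soon as u
  is adjacent to v and to every other neighbour of v in S. This condition survives the deletion of
  vertices other than u, so a single collapse can serve all sets S between two bounds, and the tree
  need not list the 4096 vertex sets one by one.\<close>

definition weights :: "'a set set \<Rightarrow> ('a \<Rightarrow> real) set" where
  "weights K = {w. (\<forall>u. 0 \<le> w u) \<and> {u. w u \<noteq> 0} \<in> K \<and> (\<Sum>u | w u \<noteq> 0. w u) = 1}"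

lemma topspace_geometric_realization: "topspace (geometric_realization K) = weights K"
  by (simp add: geometric_realization_def weights_def)

lemma geometric_realization_weights:
  "geometric_realization K = subtopology (powertop_real UNIV) (weights K)"
  by (simp add: geometric_realization_def weights_def)

lemma simplicial_complex_subset:
  "\<lbrakk>simplicial_complex K; F \<in> K; G \<subseteq> F\<rbrakk> \<Longrightarrow> G \<in> K"
  by (simp add: simplicial_complex_def)

lemma vertices_iff_singleton:
  "simplicial_complex K \<Longrightarrow> v \<in> vertices K \<longleftrightarrow> {v} \<in> K"
  by (auto simp: vertices_def simplicial_complex_def)

text \<open>The face \<open>F\<close> may be larger than the support, so one face can serve all
  points of a homotopy or a segment although their supports vary.\<close>

lemma weightsI:
  assumes K: "simplicial_complex K" and "F \<in> K" and nonneg: "\<And>u. 0 \<le> w u"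
    and supp: "\<And>u. u \<notin> F \<Longrightarrow> w u = 0" and "(\<Sum>u\<in>F. w u) = 1"
  shows "w \<in> weights K"
proof -
  have sub: "{u. w u \<noteq> 0} \<subseteq> F" using supp by blast
  moreover have "finite F" using assms by (auto simp: simplicial_complex_def)
  ultimately have "(\<Sum>u | w u \<noteq> 0. w u) = 1"
    using \<open>(\<Sum>u\<in>F. w u) = 1\<close> by (subst sum.mono_neutral_left[of F]) auto
  moreover have "{u. w u \<noteq> 0} \<in> K"
    using sub \<open>F \<in> K\<close> K by (auto simp: simplicial_complex_def)
  ultimately show ?thesis using nonneg by (simp add: weights_def)
qed

lemma weightsD:
  assumes "w \<in> weights K"
  shows "0 \<le> w u" "{u. w u \<noteq> 0} \<in> K" "(\<Sum>u | w u \<noteq> 0. w u) = 1"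
  using assms by (auto simp: weights_def)

lemma sum_weights:
  assumes "w \<in> weights K" "finite F" "{u. w u \<noteq> 0} \<subseteq> F"
  shows "(\<Sum>u\<in>F. w u) = 1"
proof -
  have "(\<Sum>u\<in>F. w u) = (\<Sum>u | w u \<noteq> 0. w u)"
    using assms by (intro sum.mono_neutral_right) auto
  then show ?thesis using weightsD[OF assms(1)] by simp
qed

lemma simplicial_complex_induced:
  "simplicial_complex K \<Longrightarrow> simplicial_complex (induced_subcomplex K W)"
  by (auto simp: simplicial_complex_def induced_subcomplex_def)

lemma weights_induced:
  "weights (induced_subcomplex K W) = {w \<in> weights K. \<forall>u. u \<notin> W \<longrightarrow> w u = 0}"
  by (auto simp: weights_def induced_subcomplex_def)

lemma geometric_realization_induced:
  "geometric_realization (induced_subcomplex K W) =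
     subtopology (geometric_realization K) (weights (induced_subcomplex K W))"
  by (simp add: geometric_realization_weights weights_induced subtopology_subtopology
      Int_absorb1 subset_iff)

lemma continuous_map_geometric_realization:
  "continuous_map X (geometric_realization K) f \<longleftrightarrow>
     (\<forall>u. continuous_map X euclideanreal (\<lambda>x. f x u)) \<and> f \<in> topspace X \<rightarrow> weights K"
  by (auto simp: geometric_realization_weights continuous_map_in_subtopology
      continuous_map_componentwise_UNIV image_subset_iff_funcset)

lemma continuous_map_weight: "continuous_map (geometric_realization K) euclideanreal (\<lambda>w. w u)"
  unfolding geometric_realization_weights
  by (intro continuous_map_from_subtopology continuous_map_product_projection) simp

section \<open>Deforming away a dominated vertex\<close>

text \<open>At time t the fraction t of the weight of v has moved to u. The total is unchanged, and
  by domination the support stays in a face. At time 1 the weight at v is 0, and points without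
  weight at v never move, so this is a deformation retraction and hence a homotopy
  equivalence.\<close>

lemma contractible_dominated:
  assumes K: "simplicial_complex K" and "u \<noteq> v"
    and dom: "\<And>F. \<lbrakk>F \<in> K; v \<in> F\<rbrakk> \<Longrightarrow> insert u F \<in> K"
    and contr: "contractible_space (geometric_realization (induced_subcomplex K (-{v})))"
  shows "contractible_space (geometric_realization K)"
proof -
  let ?X = "geometric_realization K" and ?Y = "geometric_realization (induced_subcomplex K (-{v}))"
  define h where "h = (\<lambda>(t, w::'a \<Rightarrow> real). w(v := (1 - t) * w v, u := w u + t * w v))"
  have h_app: "h (t, w) x = (if x = u then w u + t * w v else if x = v then (1 - t) * w v else w x)"
    for t w x by (simp add: h_def)
  have h_weights: "h (t, w) \<in> weights K" if "t \<in> {0..1}" and w: "w \<in> weights K" for t w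
  \<comment> \<open>Domination provides the larger face only when v lies in the support; otherwise
    the point is fixed.\<close>
  proof (cases "w v = 0")
    case True
    then have "h (t, w) = w" by (auto simp: h_def)
    with w show ?thesis by simp
  next
    case False
    let ?F = "insert u {x. w x \<noteq> 0}"
    have F: "?F \<in> K" using dom[OF weightsD(2)[OF w]] False by simp
    then have fin: "finite ?F" using K by (auto simp: simplicial_complex_def)
    show ?thesis
    proof (rule weightsI[OF K F])
      show "0 \<le> h (t, w) x" for x
        using that weightsD(1)[OF w] by (simp add: h_app)
      show "h (t, w) x = 0" if "x \<notin> ?F" for x
        using that False by (auto simp: h_app)
      \<comment> \<open>The moved weight is written as a gain at u and an equal loss at v, which
        cancel in the sum.\<close>
      have "(\<Sum>x\<in>?F. h (t, w) x) =
              (\<Sum>x\<in>?F. w x + (if x = u then t * w v else 0) - (if x = v then t * w v else 0))"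
        by (intro sum.cong) (use \<open>u \<noteq> v\<close> in \<open>auto simp: h_app algebra_simps\<close>)
      also have "\<dots> = (\<Sum>x\<in>?F. w x)"
        using fin False by (simp add: sum.distrib sum_subtractf)
      also have "\<dots> = 1" by (rule sum_weights[OF w fin]) auto
      finally show "(\<Sum>x\<in>?F. h (t, w) x) = 1" .
    qed
  qed
  let ?r = "\<lambda>w. h (1, w)"
  have cont_w: "continuous_map (prod_topology (top_of_set {0..1}) ?X) euclideanreal (\<lambda>p. snd p x)" for x
    using continuous_map_compose[OF continuous_map_snd continuous_map_weight] by (simp add: o_def)
  have cont_t: "continuous_map (prod_topology (top_of_set {0..1::real}) ?X) euclideanreal (\<lambda>p. fst p)"
    using continuous_map_compose[OF continuous_map_fst, of "top_of_set {0..1}" euclideanreal id]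
    by (simp add: o_def continuous_map_from_subtopology)
  have "continuous_map (prod_topology (top_of_set {0..1}) ?X) ?X h"
    unfolding continuous_map_geometric_realization
  proof (intro conjI allI)
    fix x
    have "continuous_map (prod_topology (top_of_set {0..1}) ?X) euclideanreal
       (\<lambda>p. if x = u then snd p u + fst p * snd p v
            else if x = v then (1 - fst p) * snd p v else snd p x)"
      by (cases "x = u"; cases "x = v")
        (auto intro!: continuous_intros cont_w cont_t)
    then show "continuous_map (prod_topology (top_of_set {0..1}) ?X) euclideanreal (\<lambda>p. h p x)"
      by (simp add: h_def case_prod_unfold if_distrib fun_upd_def cong: if_cong)
  next
    show "h \<in> topspace (prod_topology (top_of_set {0..1}) ?X) \<rightarrow> weights K"
      using h_weights by (auto simp: topspace_geometric_realization)
  qed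
  moreover have "h (0, w) = w" for w by (auto simp: h_def)
  ultimately have hom: "homotopic_with (\<lambda>x. True) ?X ?X id ?r"
    unfolding homotopic_with_def by (intro exI[of _ h]) auto
  have "continuous_map ?X ?Y ?r"
    using homotopic_with_imp_continuous_maps[OF hom] \<open>u \<noteq> v\<close>
    by (auto simp: continuous_map_geometric_realization weights_induced topspace_geometric_realization h_app)
  moreover have "continuous_map ?Y ?X id"
    by (auto simp: geometric_realization_induced continuous_map_from_subtopology)
  moreover have "homotopic_with (\<lambda>x. True) ?Y ?Y (?r \<circ> id) id"
  proof (rule homotopic_with_equal)
    show "continuous_map ?Y ?Y (?r \<circ> id)"
      by (metis calculation continuous_map_compose)
    show "(?r \<circ> id) w = id w" if "w \<in> topspace ?Y" for w
      using that by (auto simp: topspace_geometric_realization weights_induced h_def fun_upd_idem)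
  qed auto
  moreover have "homotopic_with (\<lambda>x. True) ?X ?X (id \<circ> ?r) id"
    using hom homotopic_with_symD by fastforce
  ultimately have "?X homotopy_equivalent_space ?Y"
    unfolding homotopy_equivalent_space_def by blast
  then show ?thesis using contr homotopy_equivalent_space_contractibility by blast
qed

section \<open>Faces of a sphere are not too large\<close>

text \<open>The interior of a simplex with d+2 vertices is an injective continuous image of an open
  subset of (d+1)-space. Followed by the homeomorphism to the sphere, it would have an open image in
  (d+1)-space that lies within the d-sphere.\<close>

lemma simplicial_sphere_no_large_face:
  assumes sphere: "simplicial_sphere d K" and "F \<in> K"
  shows "card F \<noteq> d + 2"
proof
  assume card: "card F = d + 2"
  have K: "simplicial_complex K" using sphere by (simp add: simplicial_sphere_def)
  then have "finite F" using \<open>F \<in> K\<close> by (simp add: simplicial_complex_def)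
  let ?E = "Euclidean_space (Suc d)" and ?X = "geometric_realization K"
  obtain h where h: "homeomorphic_map ?X (nsphere d) h"
    using sphere by (auto simp: simplicial_sphere_def homeomorphic_space)
  obtain v where v: "bij_betw v {..<Suc (Suc d)} F"
    using ex_bij_betw_nat_finite[OF \<open>finite F\<close>] card by (auto simp: atLeast0LessThan)
  define i where "i = the_inv_into {..<Suc (Suc d)} v"
  have i_v: "i (v j) = j" if "j < Suc (Suc d)" for j
    using v that by (simp add: i_def bij_betw_def the_inv_into_f_f)
  \<comment> \<open>Barycentric coordinates for vertices numbered 0 to d+1: the coordinates 0 to d
    are free, and the last one makes the total 1.\<close>
  define c where "c = (\<lambda>(x :: nat \<Rightarrow> real) j. if j \<le> d then x j else 1 - (\<Sum>k\<le>d. x k))"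
  define \<phi> where "\<phi> = (\<lambda>x u. if u \<in> F then c x (i u) else 0)"
  define U where "U = {x \<in> topspace ?E. \<forall>j\<le>Suc d. 0 < c x j}"
  have cont_coord: "continuous_map ?E euclideanreal (\<lambda>x. x j)" for j
    unfolding Euclidean_space_def
    by (intro continuous_map_from_subtopology continuous_map_product_projection) simp
  have cont_c: "continuous_map ?E euclideanreal (\<lambda>x. c x j)" for j
    unfolding c_def by (cases "j \<le> d") (auto intro!: continuous_intros cont_coord)
  have "U = topspace ?E \<inter> (\<Inter>j\<in>{..Suc d}. {x \<in> topspace ?E. c x j \<in> {0<..}})"
    by (auto simp: U_def)
  also have "openin ?E \<dots>"
    by (intro openin_Int openin_topspace openin_INT2 openin_continuous_map_preimage[OF cont_c]) auto
  finally have U: "openin ?E U" .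
  have c_less: "i u < Suc (Suc d)" if "u \<in> F" for u
    using that v unfolding i_def
    by (metis bij_betw_def lessThan_iff subset_refl the_inv_into_into)
  have \<phi>_weights: "\<phi> x \<in> weights K" if "x \<in> U" for x
  proof (rule weightsI[OF K \<open>F \<in> K\<close>])
    show "0 \<le> \<phi> x u" for u
      using that c_less[of u] by (auto simp: \<phi>_def U_def less_Suc_eq_le less_imp_le)
    have "(\<Sum>u\<in>F. \<phi> x u) = (\<Sum>j<Suc (Suc d). \<phi> x (v j))"
      by (rule sum.reindex_bij_betw[OF v, symmetric])
    also have "\<dots> = (\<Sum>j<Suc (Suc d). c x j)"
      using v by (intro sum.cong) (auto simp: \<phi>_def i_v bij_betw_def)
    also have "\<dots> = 1" by (simp add: c_def lessThan_Suc_atMost)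
    finally show "(\<Sum>u\<in>F. \<phi> x u) = 1" .
  qed (simp add: \<phi>_def)
  have "continuous_map (subtopology ?E U) euclideanreal (\<lambda>x. \<phi> x u)" for u
    unfolding \<phi>_def by (cases "u \<in> F") (auto intro: continuous_map_from_subtopology cont_c)
  then have \<phi>: "continuous_map (subtopology ?E U) ?X \<phi>"
    using \<phi>_weights by (auto simp: continuous_map_geometric_realization)
  have "continuous_map (subtopology ?E U) (nsphere d) (h \<circ> \<phi>)"
    using \<phi> h by (meson continuous_map_compose homeomorphic_imp_continuous_map)
  then have h\<phi>: "continuous_map (subtopology ?E U) ?E (h \<circ> \<phi>)"
    and image: "(h \<circ> \<phi>) ` U \<subseteq> topspace (nsphere d)"
    using openin_subset[OF U] continuous_map_image_subset_topspace
    by (fastforce simp: nsphere_def continuous_map_in_subtopology)+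
  have "inj_on \<phi> U"
  proof (rule inj_onI)
    fix x y assume xy: "x \<in> U" "y \<in> U" "\<phi> x = \<phi> y"
    show "x = y"
    proof
      fix j
      show "x j = y j"
      proof (cases "j \<le> d")
        case True
        then have "v j \<in> F" using v by (auto simp: bij_betw_def)
        then show ?thesis using fun_cong[OF xy(3), of "v j"] True by (simp add: \<phi>_def i_v c_def)
      next
        case False
        then show ?thesis using xy by (simp add: U_def topspace_Euclidean_space)
      qed
    qed
  qed
  moreover have "inj_on h (\<phi> ` U)"
    using h \<phi>_weights
    by (auto simp: homeomorphic_map_def homeomorphic_imp_injective_map topspace_geometric_realization
        intro!: inj_on_subset[OF homeomorphic_imp_injective_map[OF h]])
  ultimately have "openin ?E ((h \<circ> \<phi>) ` U)"
    by (intro invariance_of_domain_Euclidean_space[OF U h\<phi>] comp_inj_on)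
  \<comment> \<open>The barycentre, all of whose d+2 barycentric coordinates equal 1/(d+2); it shows
    that \<open>U\<close> is nonempty.\<close>
  moreover have "(\<lambda>j. if j \<le> d then 1 / (d + 2) else 0) \<in> U"
    by (auto simp: U_def c_def topspace_Euclidean_space field_simps)
  then obtain y where y: "y \<in> (h \<circ> \<phi>) ` U" by blast
  \<comment> \<open>The open image would contain a segment of the ray through y, but the sphere meets
    every line through the origin in two points.\<close>
  define r where "r = (\<lambda>t j. t * y j)"
  have y_sphere: "y \<in> topspace (nsphere d)" using y image by blast
  have "continuous_map euclideanreal ?E r"
    using y_sphere
    by (auto simp: r_def Euclidean_space_def continuous_map_in_subtopology nsphere
        continuous_map_componentwise_UNIV intro!: continuous_intros)
  ultimately have "openin euclideanreal {t \<in> topspace euclideanreal. r t \<in> (h \<circ> \<phi>) ` U}"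
    using openin_continuous_map_preimage by blast
  then have "open {t. r t \<in> (h \<circ> \<phi>) ` U}" by simp
  moreover have "r 1 \<in> (h \<circ> \<phi>) ` U" using y by (simp add: r_def)
  ultimately obtain e where e: "e > 0" "\<And>t. \<bar>t - 1\<bar> < e \<Longrightarrow> r t \<in> (h \<circ> \<phi>) ` U"
    unfolding open_dist dist_real_def by blast
  then have "r (1 + e / 2) \<in> topspace (nsphere d)" using image by (auto dest!: e(2)[of "1 + e/2"])
  then have "(1 + e / 2)\<^sup>2 * (\<Sum>j\<le>d. (y j)\<^sup>2) = 1"
    by (simp add: nsphere r_def power_mult_distrib sum_distrib_left)
  then have "(1 + e / 2)\<^sup>2 = 1" using y_sphere by (simp add: nsphere)
  then show False using e(1) by (simp add: power2_eq_1_iff)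
qed

subsection \<open>Connectedness and unicoherence\<close>

text \<open>Connectedness of the graph that \<open>K\<close> induces on \<open>W\<close>, stated by
  cuts. The empty set is linked, in agreement with \<open>connected_space\<close> for an empty
  space.\<close>

definition linked :: "'a set set \<Rightarrow> 'a set \<Rightarrow> bool" where
  "linked K W \<longleftrightarrow> (\<forall>A \<subseteq> W. A \<noteq> {} \<and> A \<noteq> W \<longrightarrow> (\<exists>a \<in> A. \<exists>b \<in> W - A. {a, b} \<in> K))"

text \<open>The straight segment from x to y stays in the closed simplex spanned by the two
  supports.\<close>

lemma connected_component_of_segment:
  assumes K: "simplicial_complex K" and x: "x \<in> weights K" and y: "y \<in> weights K"
    and F: "{u. x u \<noteq> 0} \<union> {u. y u \<noteq> 0} \<in> K"
  shows "connected_component_of (geometric_realization K) x y"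
proof -
  let ?g = "\<lambda>t u. (1 - t) * x u + t * y u"
  let ?F = "{u. x u \<noteq> 0} \<union> {u. y u \<noteq> 0}"
  have fin: "finite ?F" using F K by (simp add: simplicial_complex_def)
  have "?g t \<in> weights K" if "t \<in> {0..1}" for t
  proof (rule weightsI[OF K F])
    show "0 \<le> ?g t u" for u
      using that weightsD(1)[OF x] weightsD(1)[OF y] by simp
    show "(\<Sum>u\<in>?F. ?g t u) = 1"
      using sum_weights[OF x fin] sum_weights[OF y fin]
      by (simp add: sum.distrib flip: sum_distrib_left)
  qed auto
  then have "pathin (geometric_realization K) ?g"
    by (auto simp: pathin_def continuous_map_geometric_realization intro!: continuous_intros)
  then have "path_component_of (geometric_realization K) x y"
    unfolding path_component_of_def by (intro exI[of _ ?g]) auto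
  then show ?thesis
    using path_component_subset_connected_component_of[of "geometric_realization K" x] by auto
qed

text \<open>A cut without crossing edges yields two disjoint open unions of vertex stars that cover
  the space. Conversely, every point is joined by a segment to a vertex of its support, and vertices
  are joined along edges.\<close>

lemma connected_space_geometric_realization_iff:
  fixes K :: "'a set set"
  assumes K: "simplicial_complex K" and W: "W \<subseteq> vertices K"
  shows "connected_space (geometric_realization (induced_subcomplex K W)) \<longleftrightarrow> linked K W"
proof
  let ?L = "induced_subcomplex K W"
  let ?X = "geometric_realization ?L"
  define p where "p = (\<lambda>(a :: 'a) u. if u = a then 1 else 0 :: real)"
  have L: "simplicial_complex ?L" by (rule simplicial_complex_induced[OF K])
  have "{a} \<in> ?L" if "a \<in> W" for a
    using that W vertices_iff_singleton[OF K] by (auto simp: induced_subcomplex_def)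
  then have p: "p a \<in> weights ?L" if "a \<in> W" for a
    using that by (intro weightsI[OF L, of "{a}"]) (auto simp: p_def)
  have supp_p: "{u. p a u \<noteq> 0} = {a}" for a by (auto simp: p_def)
  {
    assume conn: "connected_space ?X"
    show "linked K W"
      unfolding linked_def
    proof (intro allI impI, rule ccontr)
      fix A assume A: "A \<subseteq> W" "A \<noteq> {} \<and> A \<noteq> W"
        and sep: "\<not> (\<exists>a\<in>A. \<exists>b\<in>W - A. {a, b} \<in> K)"
      have open_star: "openin ?X {w \<in> topspace ?X. w u \<in> {0<..}}" for u
        by (rule openin_continuous_map_preimage[OF continuous_map_weight]) simp
      \<comment> \<open>The union of the open stars of the vertices in \<open>B\<close>. A point in
        the stars of both a and b has a and b in its support, so {a, b} is then an edge.\<close>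
      define star where "star = (\<lambda>B. \<Union>u\<in>B. {w \<in> topspace ?X. w u \<in> {0<..}})"
      have open_star: "openin ?X (star B)" for B
        unfolding star_def by (intro openin_Union) (use open_star in auto)
      have cover: "topspace ?X \<subseteq> star A \<union> star (W - A)"
      proof
        fix w assume w: "w \<in> topspace ?X"
        then have "w \<in> weights ?L" by (simp add: topspace_geometric_realization)
        then have "{u. w u \<noteq> 0} \<noteq> {}" "{u. w u \<noteq> 0} \<subseteq> W" "\<And>u. 0 \<le> w u"
          using weightsD[of w ?L] sum.empty[of w] by (force simp: induced_subcomplex_def)+
        then obtain u where "u \<in> W" "w u > 0" by (force simp: less_le)
        then show "w \<in> star A \<union> star (W - A)" using w by (auto simp: star_def)
      qed
      have disj: "star A \<inter> star (W - A) = {}"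
      proof (rule ccontr)
        assume "star A \<inter> star (W - A) \<noteq> {}"
        then obtain w a b where w: "w \<in> weights ?L" and ab: "a \<in> A" "b \<in> W - A" "w a > 0" "w b > 0"
          by (auto simp: star_def topspace_geometric_realization)
        have "{u. w u \<noteq> 0} \<in> K" using weightsD(2)[OF w] by (simp add: induced_subcomplex_def)
        moreover have "{a, b} \<subseteq> {u. w u \<noteq> 0}" using ab by auto
        ultimately have "{a, b} \<in> K" by (rule simplicial_complex_subset[OF K])
        then show False using sep ab by blast
      qed
      have "p a \<in> star B" if "a \<in> B" "a \<in> W" for a B
        using p[OF that(2)] that by (auto simp: star_def topspace_geometric_realization p_def)
      then have nonempty: "star B \<noteq> {}" if "B \<noteq> {}" "B \<subseteq> W" for B
        using that by blast
      have "star A \<noteq> {}" "star (W - A) \<noteq> {}"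
        by (rule nonempty; use A in blast)+
      then have "\<exists>E1 E2. openin ?X E1 \<and> openin ?X E2 \<and> topspace ?X \<subseteq> E1 \<union> E2 \<and>
          E1 \<inter> E2 = {} \<and> E1 \<noteq> {} \<and> E2 \<noteq> {}"
        using open_star[of A] open_star[of "W - A"] cover disj
        by (intro exI[of _ "star A"] exI[of _ "star (W - A)"]) simp
      then show False using conn by (simp only: connected_space_def simp_thms)
    qed
  }
  {
    assume linked: "linked K W"
    let ?c = "connected_component_of ?X"
    have to_vertex: "\<exists>a\<in>W. ?c w (p a)" if w: "w \<in> weights ?L" for w
    proof -
      have "{u. w u \<noteq> 0} \<noteq> {}" using weightsD(3)[OF w] sum.empty[of w] by force
      then obtain a where a: "w a \<noteq> 0" by blast
      then have "a \<in> W" using weightsD(2)[OF w] by (auto simp: induced_subcomplex_def)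
      moreover have "{u. w u \<noteq> 0} \<union> {a} = {u. w u \<noteq> 0}" using a by auto
      ultimately show ?thesis
        using connected_component_of_segment[OF L w p[of a]] weightsD(2)[OF w] supp_p[of a] by auto
    qed
    have vertices: "?c (p a) (p b)" if "a \<in> W" "b \<in> W" for a b
    proof -
      \<comment> \<open>The vertices reachable from a; if some vertex of \<open>W\<close> were
        missing, an edge leaving this set would reach a further one.\<close>
      define A where "A = {b \<in> W. ?c (p a) (p b)}"
      have "a \<in> A" using \<open>a \<in> W\<close> p
        by (auto simp: A_def connected_component_of_refl topspace_geometric_realization)
      have "A = W"
      proof (rule ccontr)
        assume "A \<noteq> W"
        moreover have "A \<subseteq> W" "A \<noteq> {}" using \<open>a \<in> A\<close> by (auto simp: A_def)
        ultimately obtain b c where bc: "b \<in> A" "c \<in> W - A" "{b, c} \<in> K"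
          using linked unfolding linked_def by meson
        then have "{b} \<union> {c} \<in> ?L" by (auto simp: induced_subcomplex_def A_def insert_commute)
        then have "?c (p b) (p c)"
          using bc by (intro connected_component_of_segment[OF L] p) (auto simp: A_def supp_p)
        then have "?c (p a) (p c)"
          by (rule connected_component_of_trans[rotated]) (use bc in \<open>simp add: A_def\<close>)
        then show False using bc by (auto simp: A_def)
      qed
      then show ?thesis using \<open>b \<in> W\<close> by (auto simp: A_def)
    qed
    show "connected_space ?X"
      unfolding connected_space_iff_connected_component topspace_geometric_realization
    proof (intro ballI)
      fix w w' assume "w \<in> weights ?L" "w' \<in> weights ?L"
      then obtain a b where ab: "a \<in> W" "?c w (p a)" "b \<in> W" "?c w' (p b)"
        using to_vertex by meson
      have "?c (p b) w'" using ab(4) connected_component_of_sym[of ?X w' "p b"] by simp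
      then show "?c w w'"
        by (rule connected_component_of_trans[OF connected_component_of_trans[OF ab(2) vertices[OF ab(1,3)]]])
    qed
  }
qed

section \<open>Unicoherence of the 2-sphere\<close>

text \<open>Joins two models of the sphere: \<open>simplicial_sphere\<close> refers to
  \<open>nsphere\<close>, while the Borsukian theory speaks of spheres in a Euclidean space
  type.\<close>

lemma nsphere2_homeomorphic_sphere:
  "nsphere 2 homeomorphic_space top_of_set (sphere (0 :: real^3) 1)"
proof -
  have "pairwise orthogonal (Basis :: (real^3) set)"
    by (auto simp: pairwise_def orthogonal_def inner_not_same_Basis)
  then obtain f g where
    "homeomorphic_maps (nsphere (3 - 1)) (top_of_set (sphere (0 :: real^3) 1 \<inter> span Basis)) f g"
    using homeomorphic_maps_nsphere_euclidean_sphere[of "Basis :: (real^3) set" 3]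
      independent_Basis by auto
  then show ?thesis by (auto simp: homeomorphic_space_def)
qed

lemma connected_space_nsphere2: "connected_space (nsphere 2)"
proof -
  have "connectedin euclidean (sphere (0 :: real^3) 1)" by (simp add: connected_sphere)
  then show ?thesis
    using homeomorphic_connected_space[OF nsphere2_homeomorphic_sphere]
    unfolding connectedin_def by blast
qed

text \<open>Every map from the 2-sphere to the punctured plane is null-homotopic (it is Borsukian),
  and this implies unicoherence. The dimension matters: a circle is the union of two arcs that meet
  in two points.\<close>

lemma unicoherent_nsphere2:
  assumes hom: "X homeomorphic_space nsphere 2"
    and A: "closedin X A" "connectedin X A" and B: "closedin X B" "connectedin X B"
    and un: "A \<union> B = topspace X"
  shows "connectedin X (A \<inter> B)"
proof -
  let ?S = "sphere (0 :: real^3) 1"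
  obtain h k where hk: "homeomorphic_maps X (top_of_set ?S) h k"
    using homeomorphic_space_trans[OF hom nsphere2_homeomorphic_sphere]
    by (auto simp: homeomorphic_space_def)
  have h: "homeomorphic_map X (top_of_set ?S) h" and k: "homeomorphic_map (top_of_set ?S) X k"
    using hk homeomorphic_maps_map homeomorphic_maps_sym by blast+
  have sub: "A \<subseteq> topspace X" "B \<subseteq> topspace X" using un by auto
  have inj: "inj_on h (topspace X)" using h by (rule homeomorphic_imp_injective_map)
  have "unicoherent ?S"
    by (intro Borsukian_imp_unicoherent Borsukian_sphere) simp
  moreover have "connected (h ` C)" if "connectedin X C" for C
    using connectedin_continuous_map_image[OF homeomorphic_imp_continuous_map[OF h] that]
    by (simp add: connectedin_subtopology)
  moreover have "closedin (top_of_set ?S) (h ` C)" if "closedin X C" for C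
    using homeomorphic_map_closedness[OF h closedin_subset[OF that]] that by simp
  moreover have "h ` A \<union> h ` B = ?S"
    using homeomorphic_imp_surjective_map[OF h] un by (simp flip: image_Un)
  ultimately have "connected (h ` A \<inter> h ` B)"
    using A B unicoherentD by metis
  then have "connectedin (top_of_set ?S) (h ` (A \<inter> B))"
    using inj_on_image_Int[OF inj sub] homeomorphic_imp_surjective_map[OF h] sub
    by (auto simp: connectedin_subtopology)
  then show ?thesis
    using homeomorphic_map_connectedness[OF h, of "A \<inter> B"] sub by auto
qed

lemma closedin_weights_induced:
  "closedin (geometric_realization K) (weights (induced_subcomplex K W))"
proof -
  let ?X = "geometric_realization K"
  have "closedin ?X {w \<in> topspace ?X. w u \<in> {0}}" for u
    by (rule closedin_continuous_map_preimage[OF continuous_map_weight]) simp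
  \<comment> \<open>The whole space is inserted so that the intersected family is nonempty even when
    \<open>W\<close> is everything.\<close>
  then have "closedin ?X (\<Inter> (insert (topspace ?X) ((\<lambda>u. {w \<in> topspace ?X. w u \<in> {0}}) ` (- W))))"
    by (intro closedin_Inter) blast+
  also have "\<Inter> (insert (topspace ?X) ((\<lambda>u. {w \<in> topspace ?X. w u \<in> {0}}) ` (- W))) =
      weights (induced_subcomplex K W)"
    by (auto simp: weights_induced topspace_geometric_realization)
  finally show ?thesis .
qed

lemma connectedin_weights_induced:
  "connectedin (geometric_realization K) (weights (induced_subcomplex K W)) \<longleftrightarrow>
     connected_space (geometric_realization (induced_subcomplex K W))"
  unfolding connectedin_def geometric_realization_induced
  by (auto simp: topspace_geometric_realization weights_induced)

lemma induced_induced: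
  "induced_subcomplex (induced_subcomplex K W) W' = induced_subcomplex K (W \<inter> W')"
  by (auto simp: induced_subcomplex_def)

lemma linked_simplicial_sphere2:
  assumes K: "simplicial_complex K" and S: "S \<subseteq> vertices K"
    and sphere: "simplicial_sphere 2 (induced_subcomplex K S)"
  shows "linked K S"
proof -
  show ?thesis
    using sphere connected_space_nsphere2 homeomorphic_connected_space connected_space_geometric_realization_iff[OF K S]
    by (auto simp: simplicial_sphere_def)
qed

text \<open>Without edges between \<open>P - Q\<close> and \<open>Q - P\<close>, no face meets both,
  so the realizations over \<open>P\<close> and \<open>Q\<close> are closed connected sets covering
  the sphere. They intersect exactly in the realization over \<open>P \<inter> Q\<close>.\<close>

lemma linked_Int_simplicial_sphere2:
  assumes K: "simplicial_complex K" and S: "P \<union> Q \<subseteq> vertices K"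
    and sphere: "simplicial_sphere 2 (induced_subcomplex K (P \<union> Q))"
    and linked: "linked K P" "linked K Q"
    and cross: "\<And>a b. \<lbrakk>a \<in> P - Q; b \<in> Q - P\<rbrakk> \<Longrightarrow> {a, b} \<notin> K"
  shows "linked K (P \<inter> Q)"
proof -
  let ?L = "induced_subcomplex K (P \<union> Q)"
  let ?X = "geometric_realization ?L"
  let ?A = "\<lambda>W. weights (induced_subcomplex ?L W)"
  have conn: "connectedin ?X (?A W) \<longleftrightarrow> linked K W" if "W \<subseteq> P \<union> Q" for W
  proof -
    have "induced_subcomplex ?L W = induced_subcomplex K W"
      using that by (simp add: induced_induced Int_absorb1)
    moreover have "W \<subseteq> vertices K" using that S by blast
    ultimately show ?thesis
      using connectedin_weights_induced[of ?L W] connected_space_geometric_realization_iff[OF K, of W]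
      by simp
  qed
  have "?A P \<union> ?A Q = topspace ?X"
  proof -
    have "F \<subseteq> P \<or> F \<subseteq> Q" if "F \<in> ?L" for F
    proof (rule ccontr)
      assume "\<not> (F \<subseteq> P \<or> F \<subseteq> Q)"
      then obtain a b where "a \<in> F - Q" "b \<in> F - P" by blast
      moreover have "{a, b} \<in> K" if "a \<in> F" "b \<in> F"
        using \<open>F \<in> ?L\<close> K that by (auto simp: induced_subcomplex_def simplicial_complex_def)
      ultimately show False
        using cross[of a b] \<open>F \<in> ?L\<close> by (auto simp: induced_subcomplex_def)
    qed
    then show ?thesis
      by (auto simp: topspace_geometric_realization weights_def induced_subcomplex_def)
  qed
  then have "connectedin ?X (?A P \<inter> ?A Q)"
    using sphere linked conn
    by (intro unicoherent_nsphere2) (auto simp: simplicial_sphere_def closedin_weights_induced)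
  moreover have "?A P \<inter> ?A Q = ?A (P \<inter> Q)" by (auto simp: weights_induced)
  ultimately show ?thesis using conn[of "P \<inter> Q"] by auto
qed

section \<open>Obstructions to being a 2-sphere, and domination\<close>

text \<open>A certificate against unicoherence in terms of edges. The model is an induced cycle cut
  into two arcs with nonadjacent common ends.\<close>

definition circular :: "'a set set \<Rightarrow> 'a set \<Rightarrow> bool" where
  "circular K S \<longleftrightarrow> (\<exists>P Q. S = P \<union> Q \<and> linked K P \<and> linked K Q \<and> \<not> linked K (P \<inter> Q) \<and>
     (\<forall>a \<in> P - Q. \<forall>b \<in> Q - P. {a, b} \<notin> K))"

text \<open>The disjunction is a single predicate so that one induction along a collapse transports
  whichever obstruction its end provides.\<close>

definition nonspherical :: "'a set set \<Rightarrow> 'a set \<Rightarrow> bool" where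
  "nonspherical K S \<longleftrightarrow>
     contractible_space (geometric_realization (induced_subcomplex K S)) \<or> \<not> linked K S \<or> circular K S"

lemma nonspherical_imp_not_sphere:
  assumes K: "simplicial_complex K" and S: "S \<subseteq> vertices K" and "nonspherical K S"
  shows "\<not> simplicial_sphere 2 (induced_subcomplex K S)"
proof
  assume sphere: "simplicial_sphere 2 (induced_subcomplex K S)"
  then have "\<not> contractible_space (geometric_realization (induced_subcomplex K S))"
    using homeomorphic_space_contractibility non_contractible_space_nsphere
    by (auto simp: simplicial_sphere_def)
  moreover have "\<not> circular K S"
    using linked_Int_simplicial_sphere2[OF K] S sphere unfolding circular_def by blast
  ultimately show False
    using linked_simplicial_sphere2[OF K S sphere] \<open>nonspherical K S\<close> by (auto simp: nonspherical_def)
qed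

lemma linked_insert:
  assumes "linked K W" "u \<in> W" "{u, v} \<in> K"
  shows "linked K (insert v W)"
proof (cases "v \<in> W")
  case False
  show ?thesis
    unfolding linked_def
  proof (intro allI impI)
    fix A assume A: "A \<subseteq> insert v W" "A \<noteq> {} \<and> A \<noteq> insert v W"
    show "\<exists>a\<in>A. \<exists>b\<in>insert v W - A. {a, b} \<in> K"
    proof (cases "A - {v} = {} \<or> A - {v} = W")
      case True
      then consider "A = {v}" | "A = W" using A False by blast
      then show ?thesis
        by cases (use False assms(2,3) in \<open>auto simp: insert_commute\<close>)
    next
      case False
      moreover have "A - {v} \<subseteq> W" using A by blast
      ultimately obtain a b where "a \<in> A - {v}" "b \<in> W - (A - {v})" "{a, b} \<in> K"
        using \<open>linked K W\<close> unfolding linked_def by blast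
      then show ?thesis using \<open>v \<notin> W\<close> by blast
    qed
  qed
qed (use assms in \<open>simp add: insert_absorb\<close>)

lemma linked_path:
  assumes "simplicial_complex K" "successively (\<lambda>a b. {a, b} \<in> K) xs"
  shows "linked K (set xs)"
  using assms(2)
proof (induction xs rule: induct_list012)
  case (3 a b xs)
  then have "linked K (insert a (set (b # xs)))"
    by (intro linked_insert[of _ _ b]) (auto simp: insert_commute)
  then show ?case by simp
qed (auto simp: linked_def subset_singleton_iff)

text \<open>Put v on the side of the cut that contains u: an edge from v across the cut would give
  one from u.\<close>

lemma not_linked_insert_dominated:
  assumes K: "simplicial_complex K" and "\<not> linked K W" "u \<in> W"
    and dom: "\<And>b. \<lbrakk>b \<in> W; {v, b} \<in> K\<rbrakk> \<Longrightarrow> {u, b} \<in> K"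
  shows "\<not> linked K (insert v W)"
proof -
  obtain A where A: "A \<subseteq> W" "A \<noteq> {}" "A \<noteq> W" and sep: "\<And>a b. \<lbrakk>a \<in> A; b \<in> W - A\<rbrakk> \<Longrightarrow> {a, b} \<notin> K"
    using \<open>\<not> linked K W\<close> unfolding linked_def by blast
  show ?thesis
  proof (cases "v \<in> W")
    case False
    define B where "B = (if u \<in> A then insert v A else A)"
    have "B \<subseteq> insert v W" "B \<noteq> {}" "B \<noteq> insert v W" using A False \<open>u \<in> W\<close> by (auto simp: B_def)
    moreover have "{a, b} \<notin> K" if "a \<in> B" "b \<in> insert v W - B" for a b
      using that sep[of a b] sep[of u b] sep[of a u] dom[of a] dom[of b] A \<open>u \<in> W\<close>
      by (auto simp: B_def insert_commute split: if_splits)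
    ultimately show ?thesis unfolding linked_def by blast
  qed (use assms(2) in \<open>simp add: insert_absorb\<close>)
qed

text \<open>Contractibility uses \<open>dom\<close> for all faces. The two graph obstructions use
  only its consequence for edges, that neighbours of v in \<open>S\<close> are u or neighbours of u.
  The case \<open>v \<notin> S\<close> is allowed because a collapse may delete a vertex whose
  membership is undecided.\<close>

lemma nonspherical_dominated:
  assumes K: "simplicial_complex K" and "v \<in> vertices K" and uv: "u \<in> S" "u \<noteq> v"
    and edge: "{u, v} \<in> K"
    and dom: "\<And>F. \<lbrakk>F \<in> K; F \<subseteq> S; v \<in> F\<rbrakk> \<Longrightarrow> insert u F \<in> K"
    and bad: "nonspherical K (S - {v})"
  shows "nonspherical K S"
proof (cases "v \<in> S")
  case True
  then have S: "S = insert v (S - {v})" by blast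
  have dom_edge: "{u, b} \<in> K" if "b \<in> S" "{v, b} \<in> K" for b
    using dom[of "{v, b}"] that \<open>v \<in> S\<close> K
    by (auto simp: simplicial_complex_def)
  consider "contractible_space (geometric_realization (induced_subcomplex K (S - {v})))"
    | "\<not> linked K (S - {v})" | "circular K (S - {v})"
    using bad by (auto simp: nonspherical_def)
  then show ?thesis
  proof cases
    case 1
    have "contractible_space (geometric_realization (induced_subcomplex K S))"
    proof (rule contractible_dominated[OF simplicial_complex_induced[OF K] \<open>u \<noteq> v\<close>])
      show "insert u F \<in> induced_subcomplex K S" if "F \<in> induced_subcomplex K S" "v \<in> F" for F
        using that dom[of F] uv by (auto simp: induced_subcomplex_def)
    qed (use 1 in \<open>simp add: induced_induced Diff_eq\<close>)
    then show ?thesis by (simp add: nonspherical_def)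
  next
    case 2
    then have "\<not> linked K S"
      using not_linked_insert_dominated[OF K 2, of u v] uv dom_edge S by auto
    then show ?thesis by (simp add: nonspherical_def)
  next
    case 3
    then obtain P Q where PQ: "S - {v} = P \<union> Q" and linked: "linked K P" "linked K Q"
      and not_linked: "\<not> linked K (P \<inter> Q)" and cross: "\<forall>a \<in> P - Q. \<forall>b \<in> Q - P. {a, b} \<notin> K"
      unfolding circular_def by blast
    \<comment> \<open>The preimages of P and Q under the retraction that moves v to u.\<close>
    define P' Q' where "P' = (if u \<in> P then insert v P else P)" and "Q' = (if u \<in> Q then insert v Q else Q)"
    have "v \<notin> P" "v \<notin> Q" "u \<in> P \<union> Q" using PQ uv by auto
    have "S = P' \<union> Q'" using PQ S uv by (auto simp: P'_def Q'_def)
    moreover have "linked K P'" "linked K Q'"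
      using linked linked_insert[OF _ _ edge] by (auto simp: P'_def Q'_def)
    \<comment> \<open>The intersection gains v exactly when u lies in both parts, and then v is
      dominated there as well.\<close>
    moreover have "\<not> linked K (P' \<inter> Q')"
    proof (cases "u \<in> P \<inter> Q")
      case True
      then have "P' \<inter> Q' = insert v (P \<inter> Q)" by (auto simp: P'_def Q'_def)
      then show ?thesis
        using not_linked_insert_dominated[OF K not_linked True] dom_edge PQ by auto
    next
      case False
      then have "P' \<inter> Q' = P \<inter> Q" using \<open>v \<notin> P\<close> \<open>v \<notin> Q\<close> by (auto simp: P'_def Q'_def)
      then show ?thesis using not_linked by simp
    qed
    moreover have "{a, b} \<notin> K" if ab: "a \<in> P' - Q'" "b \<in> Q' - P'" for a b
    proof -
      \<comment> \<open>At most one end is v. If one is, then u lies on the same side, and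
        domination would replace v by u in the edge, giving a crossing edge for \<open>P\<close> and
        \<open>Q\<close>.\<close>
      consider "a \<in> P - Q" "b \<in> Q - P" | "a = v" "u \<in> P - Q" "b \<in> Q - P"
        | "a \<in> P - Q" "b = v" "u \<in> Q - P"
        using ab \<open>v \<notin> P\<close> \<open>v \<notin> Q\<close> by (auto simp: P'_def Q'_def split: if_splits)
      then show ?thesis
      proof cases
        case 1
        then show ?thesis using cross by simp
      next
        case 2
        then show ?thesis using cross dom_edge[of b] PQ by blast
      next
        case 3
        then have "{u, a} \<notin> K" using cross by (simp add: insert_commute)
        then show ?thesis using 3 dom_edge[of a] PQ by (metis UnCI DiffD1 insert_commute)
      qed
    qed
    ultimately have "circular K S" unfolding circular_def by blast
    then show ?thesis by (simp add: nonspherical_def)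
  qed
qed (use bad in simp)

text \<open>The realization has at most one point; the empty space also counts as
  contractible.\<close>

lemma nonspherical_point:
  assumes K: "simplicial_complex K" and "S \<subseteq> {a}"
  shows "nonspherical K S"
proof -
  have "topspace (geometric_realization (induced_subcomplex K S)) \<subseteq> {\<lambda>u. if u = a then 1 else 0}"
  proof
    fix w assume "w \<in> topspace (geometric_realization (induced_subcomplex K S))"
    then have w: "w \<in> weights (induced_subcomplex K S)" by (simp add: topspace_geometric_realization)
    then have supp: "{u. w u \<noteq> 0} \<subseteq> {a}"
      using assms weightsD(2)[OF w] by (auto simp: induced_subcomplex_def)
    then have "w a = 1" using sum_weights[OF w, of "{a}"] by simp
    then show "w \<in> {\<lambda>u. if u = a then 1 else 0}" using supp by fastforce
  qed
  then show ?thesis by (auto simp: nonspherical_def intro: contractible_space_subset_singleton)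
qed

text \<open>The arcs a, b, c and c, xs, a are linked and share only the nonadjacent vertices a and
  c. Chords within the second arc do no harm.\<close>

lemma nonspherical_cycle:
  assumes K: "simplicial_complex K"
    and "successively (\<lambda>a b. {a, b} \<in> K) [a, b, c]"
    and "successively (\<lambda>a b. {a, b} \<in> K) (c # xs @ [a])"
    and "{a, c} \<notin> K" and "\<And>x. x \<in> set xs \<Longrightarrow> {b, x} \<notin> K"
  shows "nonspherical K ({a, b, c} \<union> set xs)"
proof -
  let ?P = "set [a, b, c]" and ?Q = "set (c # xs @ [a])"
  have edges: "{a, b} \<in> K" "{b, c} \<in> K" using assms(2) by auto
  \<comment> \<open>Nonadjacency also yields distinctness: a repeated vertex would turn an excluded
    pair into a singleton, which is a face.\<close>
  then have "{b} \<in> K" "{a} \<in> K" using K by (auto simp: simplicial_complex_def)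
  then have distinct: "b \<notin> set xs" "b \<noteq> a" "b \<noteq> c" "a \<noteq> c"
    using assms(4) assms(5)[of b] edges by auto
  have "?P \<inter> ?Q = {a, c}" using distinct by auto
  moreover have "\<not> linked K {a, c}"
    unfolding linked_def using \<open>{a, c} \<notin> K\<close> \<open>a \<noteq> c\<close>
    by (auto intro!: exI[of _ "{a}"])
  moreover have "linked K ?P" "linked K ?Q"
    using linked_path[OF K] assms(2,3) by blast+
  moreover have "{x, y} \<notin> K" if "x \<in> ?P - ?Q" "y \<in> ?Q - ?P" for x y
    using that assms(5) by auto
  ultimately have "circular K ({a, b, c} \<union> set xs)"
    unfolding circular_def by (intro exI[of _ ?P] exI[of _ ?Q]) auto
  then show ?thesis by (simp add: nonspherical_def)
qed

subsection \<open>The complex\<close>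

text \<open>Used to multiply out the cones and octahedra into an explicit list of
  generators.\<close>

lemma join_complex_generated:
  "join_complex (generated_complex \<A>) (generated_complex \<B>) =
     generated_complex ((\<lambda>(A, B). A \<union> B) ` (\<A> \<times> \<B>))"
proof (intro equalityI subsetI)
  fix H assume "H \<in> generated_complex ((\<lambda>(A, B). A \<union> B) ` (\<A> \<times> \<B>))"
  then obtain A B where "A \<in> \<A>" "B \<in> \<B>" "H = (H \<inter> A) \<union> (H \<inter> B)"
    by (auto simp: generated_complex_def)
  then show "H \<in> join_complex (generated_complex \<A>) (generated_complex \<B>)"
    unfolding join_complex_def generated_complex_def by blast
next
  fix H assume "H \<in> join_complex (generated_complex \<A>) (generated_complex \<B>)"
  then obtain F G where H: "H = F \<union> G" "F \<in> generated_complex \<A>" "G \<in> generated_complex \<B>"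
    unfolding join_complex_def by blast
  then obtain A B where "A \<in> \<A>" "F \<subseteq> A" "B \<in> \<B>" "G \<subseteq> B"
    unfolding generated_complex_def by blast
  with H(1) show "H \<in> generated_complex ((\<lambda>(A, B). A \<union> B) ` (\<A> \<times> \<B>))"
    unfolding generated_complex_def
    by (intro CollectI bexI[of _ "A \<union> B"] image_eqI[of _ _ "(A, B)"]) auto
qed

text \<open>Lists make the finite checks executable. There are eight facets for each of the cones at
  \<open>V1\<close>, \<open>V2\<close>, \<open>V3\<close>, followed by the nine of
  \<open>Gamma2\<close>.\<close>

definition facets :: "vertex list list" where
  "facets =
   [[X1, X2, X3, V1], [X1, X2, Y3, V1], [X1, Y2, X3, V1], [X1, Y2, Y3, V1],
    [Y1, X2, X3, V1], [Y1, X2, Y3, V1], [Y1, Y2, X3, V1], [Y1, Y2, Y3, V1],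
    [Y1, Y2, Y3, V2], [Y1, Y2, Z3, V2], [Y1, Z2, Y3, V2], [Y1, Z2, Z3, V2],
    [Z1, Y2, Y3, V2], [Z1, Y2, Z3, V2], [Z1, Z2, Y3, V2], [Z1, Z2, Z3, V2],
    [X1, X2, X3, V3], [X1, X2, Z2, V3], [X1, Z1, X3, V3], [X1, Z1, Z2, V3],
    [Z3, X2, X3, V3], [Z3, X2, Z2, V3], [Z3, Z1, X3, V3], [Z3, Z1, Z2, V3],
    [X1, X2, Y3, Z2], [X2, Y1, Y3, Z2], [X2, Y1, Z2, Z3], [X2, X3, Y1, Z3],
    [X3, Y1, Y2, Z3], [X3, Y2, Z1, Z3], [X1, X3, Y2, Z1], [X1, Y2, Y3, Z1],
    [X1, Y3, Z1, Z2]]"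

lemma Delta_12_33_facets: "Delta_12_33 = {F. \<exists>G\<in>set facets. F \<subseteq> set G}"
proof -
  have "generated_complex \<A> \<union> generated_complex \<B> = generated_complex (\<A> \<union> \<B>)"
    for \<A> \<B> :: "vertex set set"
    by (auto simp: generated_complex_def)
  then have "Delta_12_33 = generated_complex (set (map set facets))"
    by (simp add: Delta_12_33_def Gamma1_def Gamma2_def cone_def octahedron_def facets_def
        join_complex_generated insert_commute)
  then show ?thesis by (auto simp: generated_complex_def)
qed

text \<open>The graph is tabulated because the certificate checks query it at every step;
  \<open>edge_iff\<close> ties the table to the complex.\<close>

fun nbrs :: "vertex \<Rightarrow> vertex list" where
  "nbrs X1 = [X2, X3, Y2, Y3, Z1, Z2, V1, V3]"
| "nbrs X2 = [X1, X3, Y1, Y3, Z2, Z3, V1, V3]"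
| "nbrs X3 = [X1, X2, Y1, Y2, Z1, Z3, V1, V3]"
| "nbrs Y1 = [X2, X3, Y2, Y3, Z2, Z3, V1, V2]"
| "nbrs Y2 = [X1, X3, Y1, Y3, Z1, Z3, V1, V2]"
| "nbrs Y3 = [X1, X2, Y1, Y2, Z1, Z2, V1, V2]"
| "nbrs Z1 = [X1, X3, Y2, Y3, Z2, Z3, V2, V3]"
| "nbrs Z2 = [X1, X2, Y1, Y3, Z1, Z3, V2, V3]"
| "nbrs Z3 = [X2, X3, Y1, Y2, Z1, Z2, V2, V3]"
| "nbrs V1 = [X1, X2, X3, Y1, Y2, Y3]"
| "nbrs V2 = [Y1, Y2, Y3, Z1, Z2, Z3]"
| "nbrs V3 = [X1, X2, X3, Z1, Z2, Z3]"

definition all_vertices :: "vertex list" where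
  "all_vertices = [X1, X2, X3, Y1, Y2, Y3, Z1, Z2, Z3, V1, V2, V3]"

lemma in_all_vertices: "v \<in> set all_vertices"
  by (cases v) (simp_all add: all_vertices_def)

lemma simplicial_complex_Delta: "simplicial_complex Delta_12_33"
proof -
  have "Delta_12_33 \<subseteq> Pow (set all_vertices)" using in_all_vertices by blast
  then have "finite Delta_12_33" by (rule finite_subset) simp
  then show ?thesis
    by (auto simp: simplicial_complex_def Delta_12_33_facets intro: finite_subset)
qed

lemma vertices_Delta: "v \<in> vertices Delta_12_33"
  by (cases v) (auto simp: vertices_def Delta_12_33_facets facets_def)

lemma card_facet: "G \<in> set facets \<Longrightarrow> card (set G) = 4"
  by (auto simp: facets_def)

section \<open>The graph of the complex and flagness\<close>

lemma edge_iff: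
  assumes "a \<noteq> b"
  shows "{a, b} \<in> Delta_12_33 \<longleftrightarrow> b \<in> set (nbrs a)"
proof -
  have "list_all (\<lambda>a. list_all (\<lambda>b. a = b \<or> List.member (nbrs a) b =
     list_ex (\<lambda>G. List.member G a \<and> List.member G b) facets) all_vertices) all_vertices"
    by code_simp
  then show ?thesis
    using assms in_all_vertices by (auto simp: Delta_12_33_facets list_all_iff list_ex_iff)
qed

text \<open>This is flagness in the form that lets domination of vertices be read off from the graph.\<close>

lemma insert_face:
  assumes "F \<in> Delta_12_33" "F \<subseteq> insert u (set (nbrs u))"
  shows "insert u F \<in> Delta_12_33"
proof -
  \<comment> \<open>Facets suffice: one facet containing u and all neighbours of u in
    \<open>G\<close> serves every face of \<open>G\<close> contained in u and its
    neighbours.\<close>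
  have "list_all (\<lambda>u. list_all (\<lambda>G. list_ex (\<lambda>G'. List.member G' u \<and>
      list_all (\<lambda>x. List.member (nbrs u) x \<longrightarrow> List.member G' x) G) facets) facets) all_vertices"
    by code_simp
  then have flag: "\<exists>G'\<in>set facets. u \<in> set G' \<and> set G \<inter> set (nbrs u) \<subseteq> set G'" if "G \<in> set facets" for G
    using in_all_vertices[of u] that
    by (auto simp: list_all_iff list_ex_iff subset_iff) meson
  obtain G where "G \<in> set facets" "F \<subseteq> set G"
    using assms(1) by (auto simp: Delta_12_33_facets)
  with flag[of G] assms(2) show ?thesis by (auto simp: Delta_12_33_facets)
qed

lemma nbrs_irrefl: "v \<notin> set (nbrs v)"
  by (cases v) simp_all

text \<open>The vertices of a link are neighbours in any complex; the converse inclusion is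
  flagness, through \<open>insert_face\<close>.\<close>

lemma induced_nbrs: "induced_subcomplex Delta_12_33 (set (nbrs v)) = link Delta_12_33 {v}"
proof (intro equalityI subsetI)
  fix F assume F: "F \<in> link Delta_12_33 {v}"
  have "x \<in> set (nbrs v)" if "x \<in> F" for x
  proof -
    have "x \<noteq> v" using F that by (auto simp: link_def)
    moreover have "{v, x} \<in> Delta_12_33"
      using F that simplicial_complex_subset[OF simplicial_complex_Delta, of "insert v F"]
      by (auto simp: link_def)
    ultimately show ?thesis by (simp add: edge_iff)
  qed
  then show "F \<in> induced_subcomplex Delta_12_33 (set (nbrs v))"
    using F by (auto simp: link_def induced_subcomplex_def)
qed (use insert_face nbrs_irrefl in \<open>auto simp: link_def induced_subcomplex_def\<close>)

subsection \<open>Case analysis\<close>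

text \<open>
  A collapse takes place inside an unknown set S with I \<open>\<subseteq>\<close> S \<open>\<subseteq>\<close> R. A pair (v, u) deletes v,
  which is dominated by u whichever undecided vertices belong to S (v itself may be undecided).
  What remains has at most one vertex, or is disconnected with A a union of components, or is the
  induced cycle a, b, c, xs in this cyclic order.
\<close>

datatype terminal = Point | Separated "vertex list" | Cycle vertex vertex vertex "vertex list"

fun collapses :: "vertex list \<Rightarrow> vertex list \<Rightarrow> (vertex \<times> vertex) list \<Rightarrow> terminal \<Rightarrow> bool" where
  "collapses I R ((v, u) # ds) t \<longleftrightarrow> List.member I u \<and> List.member (nbrs u) v \<and>
     list_all (\<lambda>w. List.member R w \<longrightarrow> w = u \<or> List.member (nbrs u) w) (nbrs v) \<and>
     collapses (removeAll v I) (removeAll v R) ds t"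
| "collapses I R [] Point \<longleftrightarrow> length R \<le> 1"
| "collapses I R [] (Separated A) \<longleftrightarrow>
     list_ex (\<lambda>a. List.member A a) I \<and> list_ex (\<lambda>b. \<not> List.member A b) I \<and>
     list_all (\<lambda>a. list_all (\<lambda>b. List.member R b \<longrightarrow> List.member A b) (nbrs a)) A"
| "collapses I R [] (Cycle a b c xs) \<longleftrightarrow>
     list_all (List.member I) (a # b # c # xs) \<and> list_all (List.member (a # b # c # xs)) R \<and>
     successively (\<lambda>x y. List.member (nbrs x) y) [a, b, c] \<and>
     successively (\<lambda>x y. List.member (nbrs x) y) (c # xs @ [a]) \<and>
     \<not> List.member (a # nbrs a) c \<and> list_all (\<lambda>x. \<not> List.member (b # nbrs b) x) xs"

lemma successively_edges:
  assumes "successively (\<lambda>x y. y \<in> set (nbrs x)) xs"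
  shows "successively (\<lambda>x y. {x, y} \<in> Delta_12_33) xs"
  using assms by (rule successively_mono) (metis edge_iff nbrs_irrefl)

text \<open>The dominating vertex lies in \<open>I\<close>, hence in \<open>S\<close>, and
  domination is tested against all of \<open>R\<close>, hence holds in \<open>S\<close>. Then
  \<open>insert_face\<close> lifts it from edges to faces.\<close>

lemma collapses_nonspherical:
  assumes "collapses I R ds t" "set I \<subseteq> S" "S \<subseteq> set R"
  shows "nonspherical Delta_12_33 S"
  using assms
proof (induction I R ds t arbitrary: S rule: collapses.induct)
  case (1 I R v u ds t)
  have uv: "u \<in> set I" "v \<in> set (nbrs u)" and
    dom: "\<And>w. \<lbrakk>w \<in> set (nbrs v); w \<in> set R\<rbrakk> \<Longrightarrow> w = u \<or> w \<in> set (nbrs u)" and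
    rec: "collapses (removeAll v I) (removeAll v R) ds t"
    using "1.prems"(1) by (auto simp: list_all_iff)
  have "nonspherical Delta_12_33 (S - {v})"
    using "1.IH"[of "S - {v}"] "1.prems" rec by auto
  moreover have "u \<noteq> v" using uv nbrs_irrefl by metis
  moreover have "insert u F \<in> Delta_12_33" if F: "F \<in> Delta_12_33" "F \<subseteq> S" "v \<in> F" for F
  proof (rule insert_face[OF F(1)], rule subsetI)
    fix x assume "x \<in> F"
    show "x \<in> insert u (set (nbrs u))"
    proof (cases "x = v")
      case False
      have "{v, x} \<in> Delta_12_33"
        using F \<open>x \<in> F\<close> by (intro simplicial_complex_subset[OF simplicial_complex_Delta F(1)]) auto
      then show ?thesis using False dom[of x] edge_iff[of v x] F \<open>x \<in> F\<close> "1.prems"(3) by auto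
    qed (use uv in simp)
  qed
  ultimately show ?case
    using uv "1.prems"(2) edge_iff[of u v]
    by (intro nonspherical_dominated[OF simplicial_complex_Delta vertices_Delta[of v], of u S]) auto
next
  case (2 I R)
  then have "length R \<le> 1" by simp
  then obtain a where "set R \<subseteq> {a}" by (cases R) auto
  then show ?case
    using nonspherical_point[OF simplicial_complex_Delta] 2(3) by blast
next
  case (3 I R A)
  then obtain a b where ab: "a \<in> set A" "a \<in> S" "b \<notin> set A" "b \<in> S"
    by (auto simp: list_ex_iff)
  have closed: "\<And>x y. \<lbrakk>x \<in> set A; y \<in> set (nbrs x); y \<in> set R\<rbrakk> \<Longrightarrow> y \<in> set A"
    using 3(1) by (auto simp: list_all_iff)
  \<comment> \<open>\<open>A\<close> may list undecided vertices, so the cut is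
    \<open>S \<inter> set A\<close>. It is proper and nonempty because \<open>I\<close> has members
    inside and outside \<open>A\<close>.\<close>
  have "\<not> linked Delta_12_33 S"
    unfolding linked_def not_all
  proof (intro exI notI)
    assume "S \<inter> set A \<subseteq> S \<longrightarrow> S \<inter> set A \<noteq> {} \<and> S \<inter> set A \<noteq> S \<longrightarrow>
      (\<exists>x\<in>S \<inter> set A. \<exists>y\<in>S - S \<inter> set A. {x, y} \<in> Delta_12_33)"
    then obtain x y where "x \<in> set A" "y \<in> S" "y \<notin> set A" "{x, y} \<in> Delta_12_33"
      using ab by blast
    then show False using closed[of x y] edge_iff[of x y] 3(3) by auto
  qed
  then show ?case by (simp add: nonspherical_def)
next
  case (4 I R a b c xs)
  \<comment> \<open>\<open>I\<close> contains the cycle and the cycle contains \<open>R\<close>, so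
    the two bounds leave no choice for \<open>S\<close>.\<close>
  then have "S = {a, b, c} \<union> set xs" by (auto simp: list_all_iff)
  moreover have "nonspherical Delta_12_33 ({a, b, c} \<union> set xs)"
  proof (rule nonspherical_cycle[OF simplicial_complex_Delta])
    show "successively (\<lambda>a b. {a, b} \<in> Delta_12_33) [a, b, c]"
      "successively (\<lambda>a b. {a, b} \<in> Delta_12_33) (c # xs @ [a])"
      by (rule successively_edges; use 4(1) in simp)+
    show "{a, c} \<notin> Delta_12_33" using 4(1) edge_iff[of a c] by auto
    show "{b, x} \<notin> Delta_12_33" if "x \<in> set xs" for x
      using 4(1) that edge_iff[of b x] by (auto simp: list_all_iff)
  qed
  ultimately show ?case by simp
qed

section \<open>Decision trees and their soundness\<close>

datatype certificate =
  Split vertex certificate certificate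
| Full
| Neighbours vertex
| Collapse "(vertex \<times> vertex) list" terminal

fun certifies :: "vertex list \<Rightarrow> vertex list \<Rightarrow> certificate \<Rightarrow> bool" where
  "certifies I R (Split v c d) \<longleftrightarrow> certifies (v # I) R c \<and> certifies I (removeAll v R) d"
| "certifies I R Full \<longleftrightarrow> list_ex (list_all (List.member I)) facets"
| "certifies I R (Neighbours v) \<longleftrightarrow>
     list_all (List.member (nbrs v)) R \<and> list_all (List.member I) (nbrs v)"
| "certifies I R (Collapse ds t) \<longleftrightarrow> collapses I R ds t"

text \<open>A split is the case distinction on \<open>v \<in> S\<close>: it either enlarges the
  lower bound \<open>I\<close> or shrinks the upper bound \<open>R\<close>. The three kinds of
  leaves correspond to the three alternatives.\<close>

lemma certifies_sound:
  assumes "certifies I R c" "set I \<subseteq> S" "S \<subseteq> set R"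
  shows "(\<exists>G\<in>set facets. set G \<subseteq> S) \<or> (\<exists>v. S = set (nbrs v)) \<or> nonspherical Delta_12_33 S"
  using assms
proof (induction I R c rule: certifies.induct)
  case (1 I R v c d)
  then show ?case by (cases "v \<in> S") auto
next
  case (2 I R)
  then show ?case by (force simp: list_ex_iff list_all_iff)
next
  case (3 I R v)
  then have "S = set (nbrs v)" by (auto simp: list_all_iff)
  then show ?case by blast
next
  case (4 I R ds t)
  then show ?case using collapses_nonspherical by simp
qed

text \<open>
  Found by computer, by dynamic programming over all partial assignments; it has the least number
  of leaves. The first branch of a split puts the vertex into S, the second one leaves it out.
\<close>

definition decision_tree :: certificate where
  "decision_tree =
  (Split X1
   (Split Y1
    (Split X2
     (Split Y2
      (Split Z1
       (Split X3
        Full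
        (Split Y3
         Full
         (Split Z2
          (Split Z3
           Full
           (Split V1
            (Split V2
             (Split V3
              Full
              (Neighbours Y3))
             (Collapse [(Z1, X1), (V3, X1), (Z2, X2), (X1, V1), (X2, Y1), (Y2, Y1), (V1, Y1)] Point))
            (Split V2
             (Collapse [(V3, X1), (X2, Z2), (X1, Z1), (Y1, V2), (Y2, Z1), (Z2, Z1), (V2, Z1)] Point)
             (Collapse [(Z1, X1), (V3, X1), (Z2, X2)] (Cycle X1 X2 Y1 [Y2])))))
          (Split Z3
           (Split V1
            (Split V2
             Full
             (Split V3
              (Neighbours X3)
              (Collapse [(Z1, Y2), (Z3, Y1), (X1, V1), (X2, Y1), (Y2, Y1), (V1, Y1)] Point)))
            (Split V3
             (Collapse [(V2, Y2), (Y1, Z3), (Y2, Z1), (X1, V3), (X2, Z3), (Z3, Z1), (V3, Z1)] Point)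
             (Collapse [(Z1, Y2), (Z3, Y1), (V2, Y1)] (Cycle X1 X2 Y1 [Y2]))))
           (Split V1
            (Collapse [(V3, X1), (Z1, Y2), (V2, Y1), (X1, V1), (X2, Y1), (Y2, Y1), (V1, Y1)] Point)
            (Collapse [(V3, X1), (Z1, Y2), (V2, Y1)] (Cycle X1 X2 Y1 [Y2])))))))
       (Split V1
        (Collapse [(V3, X2), (Z3, Y1), (V2, Y1), (Z2, X2), (X1, V1), (X2, Y1), (X3, Y1), (Y2, Y1), (Y3, Y1), (V1, Y1)] Point)
        (Split X3
         (Split Y3
          (Split Z2
           Full
           (Split Z3
            Full
            (Split V2
             Full
             (Split V3
              Full
              (Neighbours V1)))))
          (Collapse [(V3, X2), (Z3, Y1), (V2, Y1), (Z2, X2), (X1, X3), (X2, X3), (Y1, X3), (Y2, X3)] Point))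
         (Split Y3
          (Collapse [(V3, X2), (Z3, Y1), (V2, Y1), (Z2, X2), (X1, Y3), (X2, Y1), (Y2, Y1), (Y3, Y1)] Point)
          (Collapse [(V3, X2), (Z3, Y1), (V2, Y1), (Z2, X2)] (Cycle X1 X2 Y1 [Y2]))))))
      (Split Z1
       (Split Z2
        (Split Z3
         Full
         (Collapse [(V3, X1), (V1, X2), (Y3, Z2), (V2, Z2), (Z1, X1), (X1, X2), (X3, X2), (Y1, X2), (Z2, X2)] Point))
        (Split Z3
         (Split X3
          Full
          (Split Y3
           (Split V1
            Full
            (Split V2
             (Split V3
              (Neighbours Z2)
              (Collapse [(X1, Y3), (X2, Y1), (Y1, V2), (Y3, Z1), (Z3, Z1), (V2, Z1)] Point))
             (Split V3
              (Collapse [(Y1, X2), (Y3, X1), (X1, V3), (X2, Z3), (Z3, Z1), (V3, Z1)] Point)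
              (Collapse [(Y1, X2), (Y3, X1)] (Cycle X1 X2 Z3 [Z1])))))
           (Split V3
            (Collapse [(V1, X2), (Y1, Z3), (V2, Z1), (X1, V3), (X2, Z3), (Z3, Z1), (V3, Z1)] Point)
            (Collapse [(V1, X2), (Y1, Z3), (V2, Z1)] (Cycle X1 X2 Z3 [Z1])))))
         (Split Y3
          (Collapse [(V3, X1), (V1, X2), (V2, Y3), (Z1, X1), (X1, X2), (X3, X2), (Y1, X2), (Y3, X2)] Point)
          (Split V2
           (Split X3
            (Collapse [(V3, X1), (V1, X2), (X1, X3), (X2, X3)] (Cycle X3 Y1 V2 [Z1]))
            (Collapse [(V3, X1), (V1, X2)] (Cycle X1 X2 Y1 [V2, Z1])))
           (Collapse [(Z1, X1), (V3, X1), (X1, X2), (X3, X2), (Y1, X2), (V1, X2)] Point)))))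
       (Collapse [(X1, X2), (X3, X2), (V1, X2), (V3, X2), (X2, Y1), (Y3, Y1), (Z2, Y1), (Z3, Y1), (V2, Y1)] Point)))
     (Split X3
      (Split Y3
       (Split Y2
        (Split Z3
         Full
         (Collapse [(V3, X1), (X3, Y2), (V1, Y2), (X1, Y3), (Y1, Y3), (Y2, Y3), (Z1, Y3), (Z2, Y3), (V2, Y3)] Point))
        (Split Z3
         (Split Z1
          (Split Z2
           Full
           (Split V1
            (Split V2
             (Split V3
              Full
              (Neighbours Y2))
             (Collapse [(Z3, X3), (Z1, X1), (V3, X1), (X1, V1), (X3, Y1), (Y3, Y1), (V1, Y1)] Point))
            (Split V2
             (Collapse [(V3, X3), (X1, Z1), (X3, Z3), (Y1, V2), (Y3, Z1), (Z3, Z1), (V2, Z1)] Point)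
             (Collapse [(Z3, X3), (Z1, X1), (V3, X1)] (Cycle X1 X3 Y1 [Y3])))))
          (Split Z2
           (Split V1
            (Split V2
             Full
             (Split V3
              (Neighbours X2)
              (Collapse [(Z3, Y1), (Z2, Y3), (X1, V1), (X3, Y1), (Y3, Y1), (V1, Y1)] Point)))
            (Split V3
             (Collapse [(V2, Y1), (Y3, Z2), (Y1, Z3), (X1, V3), (X3, Z3), (Z3, Z2), (V3, Z2)] Point)
             (Collapse [(Z3, Y1), (V2, Y1), (Z2, Y3)] (Cycle X1 X3 Y1 [Y3]))))
           (Split V1
            (Collapse [(V3, X3), (Z3, Y1), (V2, Y1), (X1, V1), (X3, Y1), (Y3, Y1), (V1, Y1)] Point)
            (Collapse [(V3, X3), (Z3, Y1), (V2, Y1)] (Cycle X1 X3 Y1 [Y3])))))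
         (Split V1
          (Collapse [(V3, X1), (Z2, Y3), (V2, Y3), (Z1, X1), (X1, V1), (X3, Y1), (Y3, Y1), (V1, Y1)] Point)
          (Collapse [(V3, X1), (Z2, Y3), (V2, Y3), (Z1, X1)] (Cycle X1 X3 Y1 [Y3])))))
       (Split Z1
        (Split Y2
         Full
         (Split Z3
          (Collapse [(V1, X3), (X1, Z1), (V3, Z1), (X3, Z3), (Y1, Z3), (Z2, Z1), (Z3, Z1), (V2, Z1)] Point)
          (Split Z2
           (Collapse [(V3, X1), (V1, X3), (X1, Z1), (V2, Z2)] (Cycle X3 Y1 Z2 [Z1]))
           (Split V2
            (Collapse [(V3, X1), (X1, X3), (V1, X3)] (Cycle X3 Y1 V2 [Z1]))
            (Collapse [(Z1, X1), (V3, X1), (X1, X3), (Y1, X3), (V1, X3)] Point)))))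
        (Split Z2
         (Split Z3
          (Split V3
           (Collapse [(V1, X3), (V2, Y1), (Y2, X3), (Y1, Z3), (X1, V3), (X3, Z3), (Z3, Z2), (V3, Z2)] Point)
           (Collapse [(V1, X3), (Z3, Y1), (V2, Y1), (Y2, X3)] (Cycle X1 X3 Y1 [Z2])))
          (Collapse [(V3, X1), (V1, X3), (V2, Y1), (Y2, X3)] (Cycle X1 X3 Y1 [Z2])))
         (Collapse [(X1, X3), (V1, X3), (V3, X3), (X3, Y1), (Y2, Y1), (Z3, Y1), (V2, Y1)] Point))))
      (Split Z2
       (Split Y3
        (Split Z1
         Full
         (Collapse [(V2, Y1), (V1, Y3), (V3, Z2), (Z3, Y1), (X1, Y3), (Y2, Y1), (Y3, Y1), (Z2, Y1)] Point))
        (Split Y2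
         (Split Z1
          (Split Z3
           (Collapse [(V1, Y2), (X1, Z1), (V3, Z1), (Y1, Z3), (Y2, Z1), (Z2, Z1), (Z3, Z1), (V2, Z1)] Point)
           (Split V2
            (Collapse [(V3, X1), (V1, Y2), (X1, Z1), (Y1, V2), (Y2, Z1), (Z2, Z1), (V2, Z1)] Point)
            (Collapse [(Z1, X1), (V3, X1), (V1, Y2)] (Cycle X1 Y2 Y1 [Z2]))))
          (Collapse [(V2, Y1), (V1, Y2), (V3, Z2), (Z3, Y1)] (Cycle X1 Y2 Y1 [Z2])))
         (Split V1
          (Collapse [(Z1, Z2), (V2, Y1), (Z3, Z2), (V3, X1)] (Cycle X1 Z2 Y1 [V1]))
          (Collapse [(X1, Z2), (Y1, Z2), (Z1, Z2), (Z3, Z2), (V2, Z2), (V3, Z2)] Point))))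
       (Split Y2
        (Split Z1
         (Collapse [(Y1, Y2), (V1, X1), (Y3, Y2), (V2, Y2), (X1, Z1), (Y2, Z1), (Z3, Z1), (V3, Z1)] Point)
         (Split Z3
          (Split V3
           (Collapse [(V2, Y1), (Y1, Y2), (Y3, X1), (V1, X1)] (Cycle X1 Y2 Z3 [V3]))
           (Collapse [(Z3, Y1), (V2, Y1), (X1, Y2), (Y2, Y1), (Y3, Y1), (V1, Y1)] Point))
          (Collapse [(V3, X1), (V2, Y1), (X1, Y2), (Y2, Y1), (Y3, Y1), (V1, Y1)] Point)))
        (Split Y3
         (Split Z3
          (Split Z1
           (Split V2
            (Collapse [(V1, Y3), (X1, Z1), (V3, Z1), (Y1, V2), (Y3, Z1), (Z3, Z1), (V2, Z1)] Point)
            (Collapse [(V1, Y3), (X1, Z1), (V3, Z1)] (Cycle Y1 Y3 Z1 [Z3])))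
           (Split V3
            (Collapse [(V2, Y1), (V1, Y3)] (Cycle X1 Y3 Y1 [Z3, V3]))
            (Collapse [(Z3, Y1), (V2, Y1), (X1, Y3), (Y3, Y1), (V1, Y1)] Point)))
          (Collapse [(V3, X1), (X1, Y3), (V1, Y1), (Y1, Y3), (Z1, Y3), (V2, Y3)] Point))
         (Split Z1
          (Split Z3
           (Split V1
            (Collapse [(V3, Z1), (V2, Z3)] (Cycle X1 Z1 Z3 [Y1, V1]))
            (Collapse [(X1, Z1), (V3, Z1), (Y1, Z3), (Z3, Z1), (V2, Z1)] Point))
           (Split V1
            (Split V2
             (Collapse [(V3, X1)] (Cycle X1 Z1 V2 [Y1, V1]))
             (Collapse [(Z1, X1), (V3, X1), (X1, V1), (V1, Y1)] Point))
            (Split V2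
             (Collapse [(V3, X1), (X1, Z1), (Y1, V2), (V2, Z1)] Point)
             (Collapse [] (Separated [X1, Z1, V3])))))
          (Split Z3
           (Split V1
            (Split V3
             (Collapse [(V2, Y1)] (Cycle X1 V1 Y1 [Z3, V3]))
             (Collapse [(Z3, Y1), (V2, Y1), (X1, V1), (V1, Y1)] Point))
            (Split V3
             (Collapse [(V2, Y1), (Y1, Z3), (X1, V3), (V3, Z3)] Point)
             (Collapse [] (Separated [X1]))))
           (Split V1
            (Collapse [(V3, X1), (V2, Y1), (X1, V1), (V1, Y1)] Point)
            (Collapse [] (Separated [X1, V3]))))))))))
    (Split Z1
     (Split X2
      (Split Z3
       (Split V3
        (Collapse [(V1, X1), (Y2, Z1), (V2, Z1), (Y3, X1), (X1, V3), (X2, Z3), (X3, Z1), (Z2, Z1), (Z3, Z1), (V3, Z1)] Point)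
        (Split X3
         (Split Y2
          Full
          (Split Z2
           (Split Y3
            Full
            (Split V1
             Full
             (Split V2
              Full
              (Neighbours V3))))
           (Collapse [(V1, X1), (V2, Z1), (Y3, X1), (X1, X3), (X2, X3), (Z1, X3), (Z3, X3)] Point)))
         (Split Z2
          (Collapse [(V1, X1), (Y2, Z1), (V2, Z1), (Y3, X1), (X1, Z2), (X2, Z2), (Z2, Z1), (Z3, Z1)] Point)
          (Collapse [(V1, X1), (Y2, Z1), (V2, Z1), (Y3, X1)] (Cycle X1 X2 Z3 [Z1])))))
       (Collapse [(X2, X1), (X3, X1), (V1, X1), (V3, X1), (X1, Z1), (Y2, Z1), (Y3, Z1), (Z2, Z1), (V2, Z1)] Point))
      (Collapse [(V1, X1), (X1, Z1), (X3, Z1), (Y2, Z1), (Y3, Z1), (Z2, Z1), (Z3, Z1), (V2, Z1), (V3, Z1)] Point))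
     (Split Z3
      (Split Z2
       (Split X3
        (Split X2
         (Split Y3
          Full
          (Collapse [(V1, X1), (V3, X2), (V2, Z3), (Z2, X2), (X1, X3), (X2, X3), (Y2, X3), (Z3, X3)] Point))
         (Split Y2
          (Split Y3
           (Split V1
            Full
            (Split V2
             (Split V3
              (Neighbours Z1)
              (Collapse [(X3, Y2), (X1, Y3), (Y2, V2), (Y3, Z2), (Z3, Z2), (V2, Z2)] Point))
             (Split V3
              (Collapse [(Y3, X1), (Y2, X3), (X1, V3), (X3, Z3), (Z3, Z2), (V3, Z2)] Point)
              (Collapse [(Y3, X1), (Y2, X3)] (Cycle X1 X3 Z3 [Z2])))))
           (Split V3
            (Collapse [(V1, X1), (V2, Z3), (Y2, X3), (X1, V3), (X3, Z3), (Z3, Z2), (V3, Z2)] Point)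
            (Collapse [(V1, X1), (X3, Y2), (V2, Z3)] (Cycle X1 Y2 Z3 [Z2]))))
          (Split V3
           (Collapse [(V1, X1), (Y3, Z2), (V2, Z2), (X1, V3), (X3, Z3), (Z3, Z2), (V3, Z2)] Point)
           (Collapse [(V1, X1), (Y3, Z2), (V2, Z2)] (Cycle X1 X3 Z3 [Z2])))))
        (Split Y2
         (Split Y3
          (Split V2
           (Collapse [(V1, X1), (X2, Z2), (V3, Z2), (X1, Y3), (Y2, V2), (Y3, Z2), (Z3, Z2), (V2, Z2)] Point)
           (Collapse [(Y3, X1), (V1, X1), (X2, Z2), (V3, Z2)] (Cycle X1 Y2 Z3 [Z2])))
          (Collapse [(V1, X1), (X2, Z2), (V3, Z2), (V2, Z3)] (Cycle X1 Y2 Z3 [Z2])))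
         (Collapse [(V1, X1), (X1, Z2), (X2, Z2), (Y3, Z2), (Z3, Z2), (V2, Z2), (V3, Z2)] Point)))
       (Split Y2
        (Split X3
         (Collapse [(V1, X1), (V3, X3), (V2, Y2), (Y3, X1), (X1, X3), (X2, X3), (Y2, X3), (Z3, X3)] Point)
         (Split X2
          (Collapse [(V1, X1), (V3, X2), (V2, Y2), (Y3, X1)] (Cycle X1 X2 Z3 [Y2]))
          (Split V3
           (Collapse [(V1, X1), (Y3, Y2), (V2, Y2)] (Cycle X1 Y2 Z3 [V3]))
           (Collapse [(V1, X1), (X1, Y2), (Y3, Y2), (Z3, Y2), (V2, Y2)] Point))))
        (Split X2
         (Split Y3
          (Split V2
           (Collapse [(V1, X1), (X1, X2), (X3, X2), (V3, X2)] (Cycle X2 Y3 V2 [Z3]))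
           (Collapse [(Y3, X1), (V1, X1), (X1, X2), (X3, X2), (Z3, X2), (V3, X2)] Point))
          (Collapse [(V1, X1), (X1, X2), (X3, X2), (V3, X2), (X2, Z3), (V2, Z3)] Point))
         (Split X3
          (Split Y3
           (Split V2
            (Collapse [(V1, X1), (V3, X3)] (Cycle X1 X3 Z3 [V2, Y3]))
            (Collapse [(Y3, X1), (V1, X1), (X1, X3), (Z3, X3), (V3, X3)] Point))
           (Collapse [(V1, X1), (X1, X3), (V3, X3), (X3, Z3), (V2, Z3)] Point))
          (Split Y3
           (Split V2
            (Split V3
             (Collapse [(V1, X1)] (Cycle X1 Y3 V2 [Z3, V3]))
             (Collapse [(V1, X1), (X1, Y3), (Y3, V2), (V2, Z3)] Point))
            (Split V3
             (Collapse [(Y3, X1), (V1, X1), (X1, V3), (V3, Z3)] Point)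
             (Collapse [] (Separated [X1, Y3, V1]))))
           (Split V3
            (Collapse [(V1, X1), (V2, Z3), (X1, V3), (V3, Z3)] Point)
            (Collapse [] (Separated [X1, V1]))))))))
      (Split Y3
       (Collapse [(X2, X1), (X3, X1), (V1, X1), (V3, X1), (X1, Y3), (Y2, Y3), (Z2, Y3), (V2, Y3)] Point)
       (Split V2
        (Split Y2
         (Split Z2
          (Collapse [(X2, X1), (X3, X1), (V1, X1), (V3, X1)] (Cycle X1 Y2 V2 [Z2]))
          (Collapse [(X2, X1), (X3, X1), (V1, X1), (V3, X1), (X1, Y2), (V2, Y2)] Point))
         (Split Z2
          (Collapse [(X2, X1), (X3, X1), (V1, X1), (V3, X1), (X1, Z2), (V2, Z2)] Point)
          (Collapse [] (Separated [X1, X2, X3, V1, V3]))))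
        (Collapse [(X2, X1), (X3, X1), (Y2, X1), (Z2, X1), (V1, X1), (V3, X1)] Point))))))
   (Split Y1
    (Split Z1
     (Split Z3
      (Split Y3
       (Split V2
        (Collapse [(V1, Y1), (X3, Z3), (V3, Z3), (X2, Y1), (Y1, V2), (Y2, Z1), (Y3, Z1), (Z2, Z1), (Z3, Z1), (V2, Z1)] Point)
        (Split Y2
         (Split X3
          Full
          (Split Z2
           (Split X2
            Full
            (Split V1
             Full
             (Split V3
              Full
              (Neighbours V2))))
           (Collapse [(V1, Y1), (V3, Z3), (X2, Y1), (Y1, Y2), (Y3, Y2), (Z1, Y2), (Z3, Y2)] Point)))
         (Split Z2
          (Collapse [(V1, Y1), (Y3, Z2), (X2, Z3), (V3, Z1), (X3, Z3), (Y1, Z2), (Z2, Z1), (Z3, Z1)] Point)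
          (Collapse [(V1, Y1), (X3, Z3), (V3, Z3), (X2, Y1)] (Cycle Y1 Y3 Z1 [Z3])))))
       (Collapse [(V1, Y1), (X2, Z3), (V3, Z1), (X3, Z3), (Y1, Z3), (Y2, Z1), (Z2, Z1), (Z3, Z1), (V2, Z1)] Point))
      (Split Z2
       (Split Y2
        (Split X2
         (Split Y3
          Full
          (Split X3
           (Split V1
            Full
            (Split V2
             (Split V3
              (Neighbours Z3)
              (Collapse [(X2, Y1), (X3, Y2), (Y1, V2), (Y2, Z1), (Z2, Z1), (V2, Z1)] Point))
             (Split V3
              (Collapse [(Y2, X3), (Y1, X2), (X2, V3), (X3, Z1), (Z2, Z1), (V3, Z1)] Point)
              (Collapse [(Y2, X3), (Y1, X2)] (Cycle X2 X3 Z1 [Z2])))))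
           (Split V2
            (Collapse [(V1, Y1), (X2, Z2), (V3, Z1), (Y1, V2), (Y2, Z1), (Z2, Z1), (V2, Z1)] Point)
            (Collapse [(V1, Y1), (X2, Z2), (V3, Z1)] (Cycle Y1 Y2 Z1 [Z2])))))
         (Split Y3
          (Collapse [(V1, Y1), (V2, Y3), (V3, Z1), (X3, Y2), (Y1, Y3), (Y2, Y3), (Z1, Y3), (Z2, Y3)] Point)
          (Split V2
           (Collapse [(V1, Y1), (V3, Z1), (X3, Y2), (Y1, V2), (Y2, Z1), (Z2, Z1), (V2, Z1)] Point)
           (Collapse [(V1, Y1), (V3, Z1), (X3, Y2)] (Cycle Y1 Y2 Z1 [Z2])))))
        (Split X3
         (Split X2
          (Split V3
           (Collapse [(V1, X2), (Y3, Z2), (V2, Z2), (Y1, X2), (X2, V3), (X3, Z1), (Z2, Z1), (V3, Z1)] Point)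
           (Collapse [(V1, X2), (X2, Y1), (Y3, Z2), (V2, Z2)] (Cycle X3 Y1 Z2 [Z1])))
          (Collapse [(V1, Y1), (V3, Z1), (Y3, Z2), (V2, Z2)] (Cycle X3 Y1 Z2 [Z1])))
         (Collapse [(V1, Y1), (X2, Z2), (V3, Z1), (Y1, Z2), (Y3, Z1), (Z2, Z1), (V2, Z1)] Point)))
       (Split X3
        (Split Y2
         (Collapse [(V3, X3), (X2, Y1), (V1, Y1), (X3, Y2), (Y1, Y2), (Y3, Y2), (Z1, Y2), (V2, Y2)] Point)
         (Split Y3
          (Collapse [(V3, X3), (X2, Y1), (V1, Y1), (V2, Y3)] (Cycle X3 Y1 Y3 [Z1]))
          (Split V2
           (Collapse [(X2, X3), (V1, X3), (V3, X3)] (Cycle X3 Y1 V2 [Z1]))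
           (Collapse [(X2, X3), (Y1, X3), (Z1, X3), (V1, X3), (V3, X3)] Point))))
        (Split X2
         (Split Y3
          (Split V3
           (Collapse [(V1, Y1), (Y1, Y3), (Y2, Y3), (V2, Y3)] (Cycle X2 Y3 Z1 [V3]))
           (Collapse [(X2, Y1), (V1, Y1), (Y1, Y3), (Y2, Y3), (Z1, Y3), (V2, Y3)] Point))
          (Split Y2
           (Split V3
            (Collapse [(V1, Y1), (V2, Y2)] (Cycle X2 Y1 Y2 [Z1, V3]))
            (Collapse [(X2, Y1), (V1, Y1), (Y1, Y2), (Z1, Y2), (V2, Y2)] Point))
           (Split V2
            (Split V3
             (Collapse [(V1, X2)] (Cycle X2 Y1 V2 [Z1, V3]))
             (Collapse [(V1, X2), (X2, Y1), (Y1, V2), (V2, Z1)] Point))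
            (Split V3
             (Collapse [(Y1, X2), (V1, X2), (X2, V3), (V3, Z1)] Point)
             (Collapse [] (Separated [X2, Y1, V1]))))))
         (Split Y2
          (Collapse [(V1, Y1), (Y1, Y2), (Y3, Y2), (V2, Y2), (Y2, Z1), (V3, Z1)] Point)
          (Split Y3
           (Collapse [(V1, Y1), (Y1, Y3), (V2, Y3), (Y3, Z1), (V3, Z1)] Point)
           (Split V2
            (Collapse [(V1, Y1), (V3, Z1), (Y1, V2), (V2, Z1)] Point)
            (Collapse [] (Separated [Y1, V1])))))))))
     (Split X2
      (Collapse [(V3, X2), (X2, Y1), (X3, Y1), (Y2, Y1), (Y3, Y1), (Z2, Y1), (Z3, Y1), (V1, Y1), (V2, Y1)] Point)
      (Split Z3
       (Collapse [(Y2, Y1), (Y3, Y1), (V1, Y1), (V2, Y1), (X3, Z3), (Y1, Z3), (Z2, Z3), (V3, Z3)] Point)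
       (Split V3
        (Split X3
         (Split Z2
          (Collapse [(Y2, Y1), (Y3, Y1), (V1, X3), (V2, Y1)] (Cycle X3 Y1 Z2 [V3]))
          (Collapse [(V3, X3), (X3, Y1), (Y2, Y1), (Y3, Y1), (V1, Y1), (V2, Y1)] Point))
         (Split Z2
          (Collapse [(Y2, Y1), (Y3, Y1), (V1, Y1), (V2, Y1), (Y1, Z2), (V3, Z2)] Point)
          (Collapse [] (Separated [Y1, Y2, Y3, V1, V2]))))
        (Collapse [(X3, Y1), (Y2, Y1), (Y3, Y1), (Z2, Y1), (V1, Y1), (V2, Y1)] Point)))))
    (Split X2
     (Split Y3
      (Split X3
       (Split Y2
        (Split Z2
         (Split Z1
          (Split Z3
           Full
           (Split V1
            (Split V2
             Full
             (Split V3
              (Neighbours X1)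
              (Collapse [(Z2, Y3), (Z1, Y2), (X2, V1), (X3, Y2), (Y3, Y2), (V1, Y2)] Point)))
            (Split V3
             (Collapse [(V2, Y3), (Y2, Z1), (Y3, Z2), (X2, V3), (X3, Z1), (Z2, Z1), (V3, Z1)] Point)
             (Collapse [(Z2, Y3), (Z1, Y2), (V2, Y2)] (Cycle X2 X3 Y2 [Y3])))))
          (Split Z3
           (Split V1
            (Split V2
             (Split V3
              Full
              (Neighbours Y1))
             (Collapse [(Z2, X2), (V3, X2), (Z3, X3), (X2, V1), (X3, Y2), (Y3, Y2), (V1, Y2)] Point))
            (Split V2
             (Collapse [(V3, X2), (X3, Z3), (X2, Z2), (Y2, V2), (Y3, Z2), (Z3, Z2), (V2, Z2)] Point)
             (Collapse [(Z2, X2), (V3, X2), (Z3, X3)] (Cycle X2 X3 Y2 [Y3]))))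
           (Split V1
            (Collapse [(V3, X2), (Z2, Y3), (V2, Y2), (X2, V1), (X3, Y2), (Y3, Y2), (V1, Y2)] Point)
            (Collapse [(V3, X2), (Z2, Y3), (V2, Y2)] (Cycle X2 X3 Y2 [Y3])))))
         (Split V1
          (Collapse [(V3, X3), (Z1, Y2), (V2, Y2), (Z3, X3), (X2, V1), (X3, Y2), (Y3, Y2), (V1, Y2)] Point)
          (Collapse [(V3, X3), (Z1, Y2), (V2, Y2), (Z3, X3)] (Cycle X2 X3 Y2 [Y3]))))
        (Split Z1
         (Split Z2
          (Split Z3
           (Collapse [(V1, X2), (V2, Z1), (Y3, Z2), (X2, Z3), (X3, Z1), (Z2, Z1), (Z3, Z1), (V3, Z1)] Point)
           (Split V3
            (Collapse [(V1, X2), (V2, Y3), (Y3, Z2), (X2, V3), (X3, Z1), (Z2, Z1), (V3, Z1)] Point)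
            (Collapse [(V1, X2), (Z2, Y3), (V2, Y3)] (Cycle X2 X3 Z1 [Y3]))))
          (Collapse [(V1, X2), (V3, X3), (V2, Z1), (Z3, X3)] (Cycle X2 X3 Z1 [Y3])))
         (Split Z2
          (Collapse [(X3, X2), (V1, X2), (V3, X2), (X2, Z2), (Y3, Z2), (Z3, Z2), (V2, Z2)] Point)
          (Split Z3
           (Split V2
            (Collapse [(X3, X2), (V1, X2), (V3, X2)] (Cycle X2 Y3 V2 [Z3]))
            (Collapse [(X3, X2), (Y3, X2), (Z3, X2), (V1, X2), (V3, X2)] Point))
           (Collapse [(X3, X2), (V1, X2), (V3, X2), (X2, Y3), (V2, Y3)] Point)))))
       (Split Z1
        (Split Z2
         (Collapse [(V1, Y3), (Y2, Z1), (V2, Z1), (X2, Z2), (Y3, Z1), (Z2, Z1), (Z3, Z1), (V3, Z1)] Point)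
         (Split Z3
          (Collapse [(V1, Y3), (Y2, Z1), (V2, Z1), (V3, Z3)] (Cycle X2 Y3 Z1 [Z3]))
          (Split V3
           (Collapse [(Y2, Y3), (V1, X2), (V2, Y3)] (Cycle X2 Y3 Z1 [V3]))
           (Collapse [(X2, Y3), (Y2, Y3), (Z1, Y3), (V1, Y3), (V2, Y3)] Point))))
        (Split Z3
         (Split V2
          (Split Z2
           (Collapse [(V3, X2), (V1, Y3), (X2, Z2), (Y2, V2), (Y3, Z2), (Z3, Z2), (V2, Z2)] Point)
           (Collapse [(V3, X2), (V1, Y3), (Y2, V2)] (Cycle X2 Y3 V2 [Z3])))
          (Split Y2
           (Collapse [(Z2, X2), (V3, X2), (V1, Y3)] (Cycle X2 Y3 Y2 [Z3]))
           (Collapse [(Y3, X2), (Z2, X2), (Z3, X2), (V1, X2), (V3, X2)] Point)))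
         (Collapse [(V3, X2), (X2, Y3), (Y2, Y3), (Z2, Y3), (V1, Y3), (V2, Y3)] Point))))
      (Split Z3
       (Split X3
        (Collapse [(V1, X3), (X2, Z3), (X3, Z3), (Y2, Z3), (Z1, Z3), (Z2, Z3), (V2, Z3), (V3, Z3)] Point)
        (Split Y2
         (Split V1
          (Collapse [(Z1, Z3), (V3, X2), (Z2, Z3), (V2, Y2)] (Cycle X2 Z3 Y2 [V1]))
          (Collapse [(X2, Z3), (Y2, Z3), (Z1, Z3), (Z2, Z3), (V2, Z3), (V3, Z3)] Point))
         (Collapse [(V1, X2), (X2, Z3), (Z1, Z3), (Z2, Z3), (V2, Z3), (V3, Z3)] Point)))
       (Split Z1
        (Split X3
         (Split Z2
          (Split V3
           (Collapse [(V1, X3), (Y2, Z1), (V2, Z1), (X2, V3), (X3, Z1), (Z2, Z1), (V3, Z1)] Point)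
           (Collapse [(V1, X3), (Y2, Z1), (V2, Z1)] (Cycle X2 X3 Z1 [Z2])))
          (Collapse [(X2, X3), (V1, X3), (V3, X3), (X3, Z1), (Y2, Z1), (V2, Z1)] Point))
         (Split Y2
          (Split Z2
           (Split V1
            (Collapse [(V2, Z1), (V3, Z2)] (Cycle X2 Z2 Z1 [Y2, V1]))
            (Collapse [(Y2, Z1), (V2, Z1), (X2, Z2), (Z2, Z1), (V3, Z1)] Point))
           (Split V1
            (Split V3
             (Collapse [(V2, Y2)] (Cycle X2 V1 Y2 [Z1, V3]))
             (Collapse [(Z1, Y2), (V2, Y2), (X2, V1), (V1, Y2)] Point))
            (Split V3
             (Collapse [(V2, Y2), (Y2, Z1), (X2, V3), (V3, Z1)] Point)
             (Collapse [] (Separated [X2])))))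
          (Split Z2
           (Collapse [(V1, X2), (V2, Z1), (X2, Z2), (Z2, Z1), (V3, Z1)] Point)
           (Split V3
            (Collapse [(V1, X2), (V2, Z1), (X2, V3), (V3, Z1)] Point)
            (Collapse [] (Separated [X2, V1]))))))
        (Split Y2
         (Split X3
          (Split Z2
           (Split V2
            (Collapse [(V3, X2), (V1, X3)] (Cycle X2 X3 Y2 [V2, Z2]))
            (Collapse [(Z2, X2), (V3, X2), (X2, X3), (Y2, X3), (V1, X3)] Point))
           (Collapse [(V3, X2), (X2, X3), (V1, X3), (X3, Y2), (V2, Y2)] Point))
          (Split Z2
           (Split V1
            (Split V2
             (Collapse [(V3, X2)] (Cycle X2 Z2 V2 [Y2, V1]))
             (Collapse [(Z2, X2), (V3, X2), (X2, V1), (V1, Y2)] Point))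
            (Split V2
             (Collapse [(V3, X2), (X2, Z2), (Y2, V2), (V2, Z2)] Point)
             (Collapse [] (Separated [X2, Z2, V3]))))
           (Split V1
            (Collapse [(V3, X2), (V2, Y2), (X2, V1), (V1, Y2)] Point)
            (Collapse [] (Separated [X2, V3])))))
         (Split Z2
          (Collapse [(X3, X2), (V1, X2), (V3, X2), (X2, Z2), (V2, Z2)] Point)
          (Split V2
           (Collapse [] (Separated [X2, X3, V1, V3]))
           (Collapse [(X3, X2), (V1, X2), (V3, X2)] Point)))))))
     (Split Y2
      (Split Z1
       (Collapse [(V1, Y2), (X3, Z1), (Y2, Z1), (Y3, Z1), (Z2, Z1), (Z3, Z1), (V2, Z1), (V3, Z1)] Point)
       (Split Z2
        (Split Y3
         (Split Z3
          (Split V2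
           (Collapse [(V1, Y2), (X3, Z3), (V3, Z2), (Y2, V2), (Y3, Z2), (Z3, Z2), (V2, Z2)] Point)
           (Collapse [(V1, Y2), (X3, Z3), (V3, Z2)] (Cycle Y2 Y3 Z2 [Z3])))
          (Split X3
           (Split V3
            (Collapse [(V1, Y2), (V2, Y3)] (Cycle X3 Y2 Y3 [Z2, V3]))
            (Collapse [(X3, Y2), (V1, Y2), (Y2, Y3), (Z2, Y3), (V2, Y3)] Point))
           (Collapse [(V1, Y2), (Y2, Y3), (V2, Y3), (Y3, Z2), (V3, Z2)] Point)))
         (Split Z3
          (Collapse [(V1, Y2), (X3, Z3), (V3, Z2), (Y2, Z3), (Z3, Z2), (V2, Z2)] Point)
          (Split X3
           (Split V2
            (Split V3
             (Collapse [(V1, X3)] (Cycle X3 Y2 V2 [Z2, V3]))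
             (Collapse [(V1, X3), (X3, Y2), (Y2, V2), (V2, Z2)] Point))
            (Split V3
             (Collapse [(Y2, X3), (V1, X3), (X3, V3), (V3, Z2)] Point)
             (Collapse [] (Separated [X3, Y2, V1]))))
           (Split V2
            (Collapse [(V1, Y2), (V3, Z2), (Y2, V2), (V2, Z2)] Point)
            (Collapse [] (Separated [Y2, V1]))))))
        (Split X3
         (Collapse [(V3, X3), (X3, Y2), (Y3, Y2), (Z3, Y2), (V1, Y2), (V2, Y2)] Point)
         (Split Z3
          (Collapse [(Y3, Y2), (V1, Y2), (V2, Y2), (Y2, Z3), (V3, Z3)] Point)
          (Split V3
           (Collapse [] (Separated [Y2, Y3, V1, V2]))
           (Collapse [(Y3, Y2), (V1, Y2), (V2, Y2)] Point))))))
      (Split Z1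
       (Split V1
        (Split X3
         (Split Y3
          (Collapse [(Z2, Z1), (V3, X3), (Z3, Z1), (V2, Y3)] (Cycle X3 Z1 Y3 [V1]))
          (Collapse [(V1, X3), (X3, Z1), (Z2, Z1), (Z3, Z1), (V2, Z1), (V3, Z1)] Point))
         (Split Y3
          (Collapse [(V1, Y3), (Y3, Z1), (Z2, Z1), (Z3, Z1), (V2, Z1), (V3, Z1)] Point)
          (Collapse [] (Separated [Z1, Z2, Z3, V2, V3]))))
        (Collapse [(X3, Z1), (Y3, Z1), (Z2, Z1), (Z3, Z1), (V2, Z1), (V3, Z1)] Point))
       (Split X3
        (Split Y3
         (Split Z2
          (Split Z3
           (Split V1
            (Collapse [(V2, Z2), (V3, Z3)] (Cycle X3 Z3 Z2 [Y3, V1]))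
            (Collapse [(Y3, Z2), (V2, Z2), (X3, Z3), (Z3, Z2), (V3, Z2)] Point))
           (Split V1
            (Split V3
             (Collapse [(V2, Y3)] (Cycle X3 V1 Y3 [Z2, V3]))
             (Collapse [(Z2, Y3), (V2, Y3), (X3, V1), (V1, Y3)] Point))
            (Split V3
             (Collapse [(V2, Y3), (Y3, Z2), (X3, V3), (V3, Z2)] Point)
             (Collapse [] (Separated [X3])))))
          (Split Z3
           (Split V1
            (Split V2
             (Collapse [(V3, X3)] (Cycle X3 Z3 V2 [Y3, V1]))
             (Collapse [(Z3, X3), (V3, X3), (X3, V1), (V1, Y3)] Point))
            (Split V2
             (Collapse [(V3, X3), (X3, Z3), (Y3, V2), (V2, Z3)] Point)
             (Collapse [] (Separated [X3, Z3, V3]))))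
           (Split V1
            (Collapse [(V3, X3), (V2, Y3), (X3, V1), (V1, Y3)] Point)
            (Collapse [] (Separated [X3, V3])))))
         (Split Z3
          (Collapse [(V1, X3), (X3, Z3), (Z2, Z3), (V2, Z3), (V3, Z3)] Point)
          (Split Z2
           (Split V3
            (Collapse [(V1, X3), (V2, Z2), (X3, V3), (V3, Z2)] Point)
            (Collapse [] (Separated [X3, V1])))
           (Split V2
            (Collapse [] (Separated [X3, V1, V3]))
            (Collapse [(V1, X3), (V3, X3)] Point)))))
        (Split Y3
         (Split Z2
          (Collapse [(V1, Y3), (Y3, Z2), (Z3, Z2), (V2, Z2), (V3, Z2)] Point)
          (Split Z3
           (Split V2
            (Collapse [(V1, Y3), (V3, Z3), (Y3, V2), (V2, Z3)] Point)
            (Collapse [] (Separated [Y3, V1])))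
           (Split V3
            (Collapse [] (Separated [Y3, V1, V2]))
            (Collapse [(V1, Y3), (V2, Y3)] Point))))
         (Split Z2
          (Split V1
           (Collapse [] (Separated [Z2, Z3, V2, V3]))
           (Collapse [(Z3, Z2), (V2, Z2), (V3, Z2)] Point))
          (Split Z3
           (Split V1
            (Collapse [] (Separated [Z3, V2, V3]))
            (Collapse [(V2, Z3), (V3, Z3)] Point))
           (Split V1
            (Split V2
             (Collapse [] (Separated [V1]))
             (Split V3
              (Collapse [] (Separated [V1]))
              (Collapse [] Point)))
            (Split V2
             (Split V3
              (Collapse [] (Separated [V2]))
              (Collapse [] Point))
             (Split V3
              (Collapse [] Point)
              (Collapse [] Point)))))))))))))"

text \<open>The bounds at the root put no restriction on \<open>S\<close>, so this evaluation covers
  every vertex set.\<close>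

lemma certifies_decision_tree: "certifies [] all_vertices decision_tree"
  by code_simp

theorem theorem3p7:
  fixes S :: "vertex set"
  assumes "S \<subseteq> vertices Delta_12_33"
    and "simplicial_sphere 2 (induced_subcomplex Delta_12_33 S)"
  shows "\<exists>v \<in> vertices Delta_12_33.
           induced_subcomplex Delta_12_33 S = link Delta_12_33 {v}"
proof -
  have "S \<subseteq> set all_vertices" using in_all_vertices by blast
  then consider G where "G \<in> set facets" "set G \<subseteq> S" | v where "S = set (nbrs v)"
    | "nonspherical Delta_12_33 S"
    using certifies_sound[OF certifies_decision_tree, of S] by auto
  then show ?thesis
  proof cases
    case 1
    then have "set G \<in> induced_subcomplex Delta_12_33 S"
      by (auto simp: induced_subcomplex_def Delta_12_33_facets)
    \<comment> \<open>A facet has four vertices, which is d+2 for d = 2.\<close>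
    then have "card (set G) \<noteq> 2 + 2" by (rule simplicial_sphere_no_large_face[OF assms(2)])
    then show ?thesis using card_facet[OF 1(1)] by simp
  next
    case 2
    then show ?thesis using induced_nbrs vertices_Delta by blast
  next
    case 3
    then show ?thesis
      using nonspherical_imp_not_sphere[OF simplicial_complex_Delta assms(1)] assms(2) by blast
  qed
qed

end
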